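(* Let $p\in(1,2]$, $q=p'=\frac{p}{p-1}$, $0<\alpha<\frac{2\langle k\rangle+N+a-2}{q}$ and $\beta>0$. There exists a finite constant $c(\alpha,\beta)$ such that \[\|\mathcal{F}_{k,a}f\|_{L^q_{k,a}}\le c(\alpha,\beta)\bigl\|\|\cdot\|^\alpha f\bigr\|_{L^p_{k,a}}^{\frac{\beta}{\alpha+\beta}}\bigl\|\|\cdot\|^\beta\mathcal{F}_{k,a}f\bigr\|_{L^q_{k,a}}^{\frac{\alpha}{\alpha+\beta}}\quad\text{for all } f\in L^p_{k,a}(\mathbb{R}^N).\]
   Context: Let $N\ge1$ and let $\langle\cdot,\cdot\rangle$, $\|\cdot\|$ be the Euclidean inner product and norm on $\mathbb{R}^N$. Let $\mathcal{R}\subset\mathbb{R}^N\setminus\{0\}$ be a reduced root system with positive subsystem $\mathcal{R}^+$, let $r_\alpha(x)=x-2\frac{\langle\alpha,x\rangle}{\|\alpha\|^2}\alpha$, let $\mathfrak{C}$ be the finite group generated by the $r_\alpha$, and let $k:\mathcal{R}\to[0,\infty)$, $\alpha\mapsto k_\alpha$, be a $\mathfrak{C}$-invariant (multiplicity) function; $\langle k\rangle=\sum_{\alpha\in\mathcal{R}^+}k_\alpha$. For $a>0$ put $\vartheta_k(x)=\prod_{\alpha\in\mathcal{R}^+}|\langle\alpha,x\rangle|^{2k_\alpha}$, $\vartheta_{k,a}(x)=\|x\|^{a-2}\vartheta_k(x)$, $d\mu_{k,a}(x)=\vartheta_{k,a}(x)\,dx$, $L^p_{k,a}(\mathbb{R}^N)=L^p(\mathbb{R}^N,\mu_{k,a})$.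 The Dunkl Laplacian is $\Delta_kf(x)=\Delta f(x)+\sum_{\alpha\in\mathcal{R}^+}k_\alpha\bigl(\frac{2\langle\nabla f(x),\alpha\rangle}{\langle\alpha,x\rangle}-\|\alpha\|^2\frac{f(x)-f(r_\alpha x)}{\langle\alpha,x\rangle^2}\bigr)$. Assume $a+2\langle k\rangle+N>2$. The $(k,a)$-generalized Fourier transform is the unitary operator on $L^2_{k,a}(\mathbb{R}^N)$ given by $\mathcal{F}_{k,a}=\exp\bigl[\frac{i\pi}{2a}(2\langle k\rangle+N+a-2)\bigr]\exp\bigl[\frac{i\pi}{2a}(\|x\|^{2-a}\Delta_k-\|x\|^a)\bigr]$. Equivalently, it is the unitary operator determined by $\mathcal{F}_{k,a}\Phi_{\ell}(p,\cdot)=e^{-i\pi(\ell+m/a)}\Phi_\ell(p,\cdot)$ for $\ell,m\in\{0,1,2,\dots\}$ and $p$ a homogeneous polynomial of degree $m$ with $\Delta_kp=0$, where $\Phi_\ell(p,x)=p(x)L_\ell^{(\lambda_m)}(\frac2a\|x\|^a)e^{-\|x\|^a/a}$, $\lambda_m=\frac1a(2m+2\langle k\rangle+N-2)$, and $L_\ell^{(\lambda)}$ are Laguerre polynomials (these functions span a dense subspace). Weighted norms may take the value $+\infty$; the constant may depend on $p,N,k,a$ but not on $f$. Standing assumption (boundedness of the integral kernel): there is a finite constant $C_0$ with $\|\mathcal{F}_{k,a}f\|_\infty\le C_0\|f\|_{L^1_{k,a}}$ for all $f\in L^1_{k,a}\cap L^2_{k,a}$. Then $\mathcal{F}_{k,a}$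 extends by continuity to $L^1_{k,a}+L^2_{k,a}$, in particular to $L^p_{k,a}$ for $1\le p\le2$. *)

theory Defs
  imports "HOL-Analysis.Analysis" "HOL-Probability.Essential_Supremum"
begin

text \<open>
  The space \<open>\<real>\<^sup>N\<close> is an arbitrary Euclidean space \<open>'a\<close> with \<open>N = DIM('a) \<ge> 1\<close>. Functions are
  complex valued, and elements of \<open>L\<^sup>p\<close> are represented by Borel functions, so identities between
  them are required almost everywhere only.
\<close>

section \<open>Root systems and multiplicity functions\<close>

definition reflection :: "'a::euclidean_space \<Rightarrow> 'a \<Rightarrow> 'a" where
  "reflection \<alpha> x = x - (2 * (\<alpha> \<bullet> x) / (norm \<alpha>)\<^sup>2) *\<^sub>R \<alpha>"

text \<open>As usual in Dunkl theory, a root system need not span and need not be crystallographic;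
  the empty one is allowed.\<close>

definition reduced_root_system :: "'a::euclidean_space set \<Rightarrow> bool" where
  "reduced_root_system R \<longleftrightarrow>
     finite R \<and> 0 \<notin> R \<and>
     (\<forall>\<alpha>\<in>R. reflection \<alpha> ` R = R) \<and>
     (\<forall>\<alpha>\<in>R. R \<inter> range (\<lambda>c. c *\<^sub>R \<alpha>) = {\<alpha>, - \<alpha>})"

definition positive_subsystem :: "'a::euclidean_space set \<Rightarrow> 'a set \<Rightarrow> bool" where
  "positive_subsystem R Rp \<longleftrightarrow>
     (\<exists>u. (\<forall>\<alpha>\<in>R. u \<bullet> \<alpha> \<noteq> 0) \<and> Rp = {\<alpha> \<in> R. u \<bullet> \<alpha> > 0})"

text \<open>Reflections are involutions, so closure under composition already gives the generated group.\<close>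

inductive_set reflection_group :: "'a::euclidean_space set \<Rightarrow> ('a \<Rightarrow> 'a) set"
  for R :: "'a set" where
  refl_id: "id \<in> reflection_group R"
| refl_comp: "g \<in> reflection_group R \<Longrightarrow> \<alpha> \<in> R \<Longrightarrow> reflection \<alpha> \<circ> g \<in> reflection_group R"

definition multiplicity_function :: "'a::euclidean_space set \<Rightarrow> ('a \<Rightarrow> real) \<Rightarrow> bool" where
  "multiplicity_function R k \<longleftrightarrow>
     (\<forall>\<alpha>\<in>R. 0 \<le> k \<alpha>) \<and> (\<forall>g\<in>reflection_group R. \<forall>\<alpha>\<in>R. k (g \<alpha>) = k \<alpha>)"

definition total_mult :: "'a::euclidean_space set \<Rightarrow> ('a \<Rightarrow> real) \<Rightarrow> real" where
  "total_mult Rp k = (\<Sum>\<alpha>\<in>Rp. k \<alpha>)"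

section \<open>The weighted measure\<close>

text \<open>Since \<open>0 powr 0 = 0\<close> in HOL, the weights below may differ from their usual values at points
  of the reflecting hyperplanes and at the origin, i.e. on a Lebesgue null set.\<close>

definition weight_k :: "'a::euclidean_space set \<Rightarrow> ('a \<Rightarrow> real) \<Rightarrow> 'a \<Rightarrow> real" where
  "weight_k Rp k x = (\<Prod>\<alpha>\<in>Rp. \<bar>\<alpha> \<bullet> x\<bar> powr (2 * k \<alpha>))"

definition weight_ka :: "'a::euclidean_space set \<Rightarrow> ('a \<Rightarrow> real) \<Rightarrow> real \<Rightarrow> 'a \<Rightarrow> real" where
  "weight_ka Rp k a x = norm x powr (a - 2) * weight_k Rp k x"

definition mu_ka :: "'a::euclidean_space set \<Rightarrow> ('a \<Rightarrow> real) \<Rightarrow> real \<Rightarrow> 'a measure" where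
  "mu_ka Rp k a = density lborel (\<lambda>x. ennreal (weight_ka Rp k a x))"

section \<open>Lebesgue spaces\<close>

text \<open>Only used with exponent \<open>r > 0\<close>.\<close>

definition ennpowr :: "ennreal \<Rightarrow> real \<Rightarrow> ennreal" where
  "ennpowr x r = (if x = \<infinity> then \<infinity> else ennreal (enn2real x powr r))"

definition Lp_norm :: "'a measure \<Rightarrow> real \<Rightarrow> ('a \<Rightarrow> complex) \<Rightarrow> ennreal" where
  "Lp_norm M p f = ennpowr (\<integral>\<^sup>+ x. ennreal (cmod (f x) powr p) \<partial>M) (1 / p)"

definition Lp_space :: "'a measure \<Rightarrow> real \<Rightarrow> ('a \<Rightarrow> complex) set" where
  "Lp_space M p = {f \<in> borel_measurable M. Lp_norm M p f < \<infinity>}"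

definition Linf_norm :: "'a measure \<Rightarrow> ('a \<Rightarrow> complex) \<Rightarrow> ennreal" where
  "Linf_norm M f = esssup M (\<lambda>x. ennreal (cmod (f x)))"

definition unitary_L2 :: "'a measure \<Rightarrow> (('a \<Rightarrow> complex) \<Rightarrow> ('a \<Rightarrow> complex)) \<Rightarrow> bool" where
  "unitary_L2 M F \<longleftrightarrow>
     (\<forall>f\<in>Lp_space M 2. F f \<in> Lp_space M 2) \<and>
     (\<forall>f\<in>Lp_space M 2. \<forall>g\<in>Lp_space M 2.
        AE x in M. F (\<lambda>y. f y + g y) x = F f x + F g x) \<and>
     (\<forall>c. \<forall>f\<in>Lp_space M 2. AE x in M. F (\<lambda>y. c * f y) x = c * F f x) \<and>
     (\<forall>f\<in>Lp_space M 2. Lp_norm M 2 (F f) = Lp_norm M 2 f) \<and>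
     (\<forall>g\<in>Lp_space M 2. \<exists>f\<in>Lp_space M 2. AE x in M. F f x = g x)"

section \<open>The Dunkl Laplacian and the functions \<open>\<Phi>\<^sub>l(p,\<cdot>)\<close>\<close>

definition laplacian :: "('a::euclidean_space \<Rightarrow> complex) \<Rightarrow> 'a \<Rightarrow> complex" where
  "laplacian f x =
     (\<Sum>b\<in>Basis. frechet_derivative (\<lambda>y. frechet_derivative f (at y) b) (at x) b)"

text \<open>The directional derivative \<open>frechet_derivative f (at x) \<alpha>\<close> is \<open>\<langle>\<nabla>f(x), \<alpha>\<rangle>\<close>. The formula is
  meaningful at points off the reflecting hyperplanes.\<close>

definition dunkl_laplacian ::
  "'a::euclidean_space set \<Rightarrow> ('a \<Rightarrow> real) \<Rightarrow> ('a \<Rightarrow> complex) \<Rightarrow> 'a \<Rightarrow> complex" where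
  "dunkl_laplacian Rp k f x =
     laplacian f x +
     (\<Sum>\<alpha>\<in>Rp. k \<alpha> *\<^sub>R
        ((2 / (\<alpha> \<bullet> x)) *\<^sub>R frechet_derivative f (at x) \<alpha>
         - ((norm \<alpha>)\<^sup>2 / (\<alpha> \<bullet> x)\<^sup>2) *\<^sub>R (f x - f (reflection \<alpha> x))))"

definition homogeneous_polynomial :: "nat \<Rightarrow> ('a::euclidean_space \<Rightarrow> complex) \<Rightarrow> bool" where
  "homogeneous_polynomial m p \<longleftrightarrow>
     polynomial_function p \<and> (\<forall>t x. p (t *\<^sub>R x) = t ^ m *\<^sub>R p x)"

text \<open>For a polynomial \<open>p\<close>, \<open>\<Delta>\<^sub>kp\<close> is again a polynomial, so it vanishes iff it vanishes on the
  dense complement of the reflecting hyperplanes.\<close>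

definition dunkl_harmonic ::
  "'a::euclidean_space set \<Rightarrow> ('a \<Rightarrow> real) \<Rightarrow> ('a \<Rightarrow> complex) \<Rightarrow> bool" where
  "dunkl_harmonic Rp k p \<longleftrightarrow>
     (\<forall>x. (\<forall>\<alpha>\<in>Rp. \<alpha> \<bullet> x \<noteq> 0) \<longrightarrow> dunkl_laplacian Rp k p x = 0)"

definition laguerre :: "nat \<Rightarrow> real \<Rightarrow> real \<Rightarrow> real" where
  "laguerre l lam t =
     (\<Sum>j\<le>l. (- 1) ^ j * ((lam + real l) gchoose (l - j)) * t ^ j / fact j)"

definition Phi_ka ::
  "'a::euclidean_space set \<Rightarrow> ('a \<Rightarrow> real) \<Rightarrow> real \<Rightarrow> nat \<Rightarrow> nat \<Rightarrow> ('a \<Rightarrow> complex) \<Rightarrow> 'a \<Rightarrow> complex"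
  where
  "Phi_ka Rp k a l m p x =
     (let lam = (2 * real m + 2 * total_mult Rp k + real DIM('a) - 2) / a
      in p x * complex_of_real
           (laguerre l lam (2 / a * norm x powr a) * exp (- (norm x powr a) / a)))"

section \<open>The \<open>(k,a)\<close>-generalized Fourier transform\<close>

text \<open>The functions \<open>\<Phi>\<^sub>l(p,\<cdot>)\<close> span a dense subspace of \<open>L\<^sup>2\<close>, hence the following property determines
  \<open>F\<close> on \<open>L\<^sup>2\<close> up to null sets.\<close>

definition is_ka_fourier ::
  "'a::euclidean_space set \<Rightarrow> ('a \<Rightarrow> real) \<Rightarrow> real \<Rightarrow>
   (('a \<Rightarrow> complex) \<Rightarrow> ('a \<Rightarrow> complex)) \<Rightarrow> bool" where
  "is_ka_fourier Rp k a F \<longleftrightarrow>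
     unitary_L2 (mu_ka Rp k a) F \<and>
     (\<forall>l m p. homogeneous_polynomial m p \<longrightarrow> dunkl_harmonic Rp k p \<longrightarrow>
        (AE x in mu_ka Rp k a. F (Phi_ka Rp k a l m p) x =
           exp (- (\<i> * complex_of_real (pi * (real l + real m / a)))) * Phi_ka Rp k a l m p x))"

text \<open>\<open>g\<close> is a value at \<open>f \<in> L\<^sup>1 + L\<^sup>2\<close> of the extension of \<open>F\<close>: on \<open>L\<^sup>1\<close> the transform is extended
  from \<open>L\<^sup>1 \<inter> L\<^sup>2\<close> by continuity as a map into \<open>L\<^sup>\<infinity>\<close>, and to the sum by additivity. If \<open>F\<close> is bounded
  from \<open>L\<^sup>1 \<inter> L\<^sup>2\<close> (with the \<open>L\<^sup>1\<close> norm) to \<open>L\<^sup>\<infinity>\<close>, then \<open>g\<close> exists, and up to null sets it does not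
  depend on the decomposition \<open>f = f\<^sub>1 + f\<^sub>2\<close> or on the approximating sequence \<open>h\<close>.\<close>

definition extension_value ::
  "'a measure \<Rightarrow> (('a \<Rightarrow> complex) \<Rightarrow> ('a \<Rightarrow> complex)) \<Rightarrow>
   ('a \<Rightarrow> complex) \<Rightarrow> ('a \<Rightarrow> complex) \<Rightarrow> bool" where
  "extension_value M F f g \<longleftrightarrow>
     g \<in> borel_measurable M \<and>
     (\<exists>f1\<in>Lp_space M 1. \<exists>f2\<in>Lp_space M 2. \<exists>g1\<in>borel_measurable M. \<exists>h.
        (AE x in M. f x = f1 x + f2 x) \<and>
        (\<forall>n. h n \<in> Lp_space M 1 \<inter> Lp_space M 2) \<and>
        (\<lambda>n. Lp_norm M 1 (\<lambda>x. h n x - f1 x)) \<longlonglongrightarrow> 0 \<and>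
        (\<lambda>n. Linf_norm M (\<lambda>x. F (h n) x - g1 x)) \<longlonglongrightarrow> 0 \<and>
        (AE x in M. g x = g1 x + F f2 x))"

definition extend ::
  "'a measure \<Rightarrow> (('a \<Rightarrow> complex) \<Rightarrow> ('a \<Rightarrow> complex)) \<Rightarrow> ('a \<Rightarrow> complex) \<Rightarrow> ('a \<Rightarrow> complex)" where
  "extend M F f = (SOME g. extension_value M F f g)"

definition norm_weighted :: "real \<Rightarrow> ('a::euclidean_space \<Rightarrow> complex) \<Rightarrow> 'a \<Rightarrow> complex" where
  "norm_weighted s f x = complex_of_real (norm x powr s) * f x"

end

theory Submission
  imports Defs
begin

text \<open>
  Put \<open>D = 2\<langle>k\<rangle> + N + a - 2\<close>, the homogeneous dimension of \<open>\<mu>\<^sub>k\<^sub>,\<^sub>a\<close>. The \<open>L\<^sup>1 \<rightarrow> L\<^sup>\<infinity>\<close> and \<open>L\<^sup>2 \<rightarrow> L\<^sup>2\<close>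
  bounds interpolate to a Hausdorff--Young inequality, for which Marcinkiewicz's argument suffices
  since the constant does not matter. For \<open>s > 0\<close> split \<open>f\<close> at \<open>\<parallel>x\<parallel> = 1 / s\<close>. By Hoelder the inner part
  has \<open>L\<^sup>1\<close> norm at most a constant times \<open>s powr (\<alpha> - D / q) * A\<close> with \<open>A\<close> the \<open>L\<^sup>p\<close> norm of
  \<open>\<parallel>x\<parallel> powr \<alpha> * f\<close>; here \<open>\<alpha> < D / q\<close> is used. So its transform has \<open>L\<^sup>q\<close> norm \<open>O(s powr \<alpha> * A)\<close> on the
  ball of radius \<open>s\<close>, and by Hausdorff--Young so has the transform of the outer part. Outside this
  ball the transform of \<open>f\<close> has \<open>L\<^sup>q\<close> norm at most \<open>s powr (- \<beta>) * B\<close> with \<open>B\<close> its weighted norm. The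
  choice of \<open>s\<close> that equates the two bounds gives the product form.
\<close>

section \<open>Lebesgue spaces\<close>

lemma ennpowr_ennreal: "0 \<le> t \<Longrightarrow> ennpowr (ennreal t) r = ennreal (t powr r)"
  by (simp add: ennpowr_def)

lemma ennpowr_top [simp]: "ennpowr \<infinity> r = \<infinity>" "ennpowr top r = top"
  by (simp_all add: ennpowr_def)

lemma ennpowr_zero [simp]: "ennpowr 0 r = 0"
  by (simp add: ennpowr_def)

lemma ennpowr_one [simp]: "ennpowr x 1 = x"
  by (cases x) (simp_all add: ennpowr_def)

lemma ennpowr_mono:
  assumes "x \<le> y" "0 \<le> r"
  shows "ennpowr x r \<le> ennpowr y r"
  using assms by (cases x; cases y) (auto simp: ennpowr_ennreal top_unique intro!: powr_mono2)

lemma Lp_norm_1: "Lp_norm M 1 f = (\<integral>\<^sup>+ x. ennreal (cmod (f x)) \<partial>M)"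
  by (simp add: Lp_norm_def)

lemma Lp_space_iff:
  "f \<in> Lp_space M p \<longleftrightarrow>
     f \<in> borel_measurable M \<and> (\<integral>\<^sup>+ x. ennreal (cmod (f x) powr p) \<partial>M) < \<infinity>"
  by (auto simp: Lp_space_def Lp_norm_def ennpowr_def less_top)

lemma Lp_space_1_iff:
  "f \<in> Lp_space M 1 \<longleftrightarrow>
     f \<in> borel_measurable M \<and> (\<integral>\<^sup>+ x. ennreal (cmod (f x)) \<partial>M) < \<infinity>"
  by (simp add: Lp_space_iff)

lemma Lp_norm_eq_ennrealD:
  assumes "Lp_norm M p f = ennreal B" "0 \<le> B" "0 < p"
  shows "(\<integral>\<^sup>+ x. ennreal (cmod (f x) powr p) \<partial>M) = ennreal (B powr p)"
  using assms
  by (cases "\<integral>\<^sup>+ x. ennreal (cmod (f x) powr p) \<partial>M")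
     (auto simp: Lp_norm_def ennpowr_ennreal powr_powr)

lemma Lp_norm_le:
  assumes "(\<integral>\<^sup>+ x. ennreal (cmod (f x) powr p) \<partial>M) \<le> ennreal (B powr p)" "0 \<le> B" "0 < p"
  shows "Lp_norm M p f \<le> ennreal B"
  unfolding Lp_norm_def using ennpowr_mono[OF assms(1), of "1 / p"] assms(2,3)
  by (simp add: ennpowr_ennreal powr_powr)

lemma Lp_norm_eq_0_iff:
  assumes "f \<in> borel_measurable M"
  shows "Lp_norm M p f = 0 \<longleftrightarrow> (AE x in M. f x = 0)"
proof -
  have "Lp_norm M p f = 0 \<longleftrightarrow> (\<integral>\<^sup>+ x. ennreal (cmod (f x) powr p) \<partial>M) = 0"
    by (cases "\<integral>\<^sup>+ x. ennreal (cmod (f x) powr p) \<partial>M")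
       (auto simp: Lp_norm_def ennpowr_ennreal)
  also have "\<dots> \<longleftrightarrow> (AE x in M. f x = 0)"
    using assms by (simp add: nn_integral_0_iff_AE)
  finally show ?thesis .
qed

text \<open>Bounding the sum by twice the maximum treats every exponent \<open>p \<ge> 0\<close>
  alike, also those below 1, where \<open>t powr p\<close> is not convex.\<close>

lemma powr_add_le:
  fixes x y p :: real
  assumes "0 \<le> x" "0 \<le> y" "0 \<le> p"
  shows "(x + y) powr p \<le> 2 powr p * (x powr p + y powr p)"
proof -
  have "(x + y) powr p \<le> (2 * max x y) powr p"
    using assms by (intro powr_mono2) auto
  also have "\<dots> = 2 powr p * max x y powr p"
    using assms by (simp add: powr_mult)
  also have "\<dots> \<le> 2 powr p * (x powr p + y powr p)"
    by (intro mult_left_mono) (auto simp: max_def)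
  finally show ?thesis .
qed

section \<open>Linear operations and domination in L^p\<close>

lemma Lp_space_add:
  assumes f: "f \<in> Lp_space M p" and g: "g \<in> Lp_space M p" and "0 \<le> p"
  shows "(\<lambda>x. f x + g x) \<in> Lp_space M p"
proof -
  have [measurable]: "f \<in> borel_measurable M" "g \<in> borel_measurable M"
    using f g by (auto simp: Lp_space_iff)
  have "cmod (f x + g x) powr p \<le> 2 powr p * (cmod (f x) powr p + cmod (g x) powr p)" for x
    by (rule order_trans[OF powr_mono2 powr_add_le]) (auto simp: assms norm_triangle_ineq)
  then have "(\<integral>\<^sup>+ x. ennreal (cmod (f x + g x) powr p) \<partial>M)
      \<le> (\<integral>\<^sup>+ x. ennreal (2 powr p) * (ennreal (cmod (f x) powr p) + ennreal (cmod (g x) powr p)) \<partial>M)"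
    by (intro nn_integral_mono) (simp flip: ennreal_plus ennreal_mult)
  also have "\<dots> < \<infinity>"
    using f g by (simp add: nn_integral_cmult nn_integral_add Lp_space_iff ennreal_mult_less_top)
  finally show ?thesis by (simp add: Lp_space_iff)
qed

lemma Lp_space_cmult:
  assumes f: "f \<in> Lp_space M p"
  shows "(\<lambda>x. c * f x) \<in> Lp_space M p"
proof -
  have [measurable]: "f \<in> borel_measurable M"
    using f by (auto simp: Lp_space_iff)
  show ?thesis
    using f by (simp add: Lp_space_iff norm_mult powr_mult ennreal_mult nn_integral_cmult
        ennreal_mult_less_top)
qed

lemma Lp_space_diff:
  assumes "f \<in> Lp_space M p" "g \<in> Lp_space M p" "0 \<le> p"
  shows "(\<lambda>x. f x - g x) \<in> Lp_space M p"
  using Lp_space_add[OF assms(1) Lp_space_cmult[OF assms(2), of "-1"] assms(3)] by simp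

lemma Lp_space_mono:
  assumes "g \<in> Lp_space M p" "f \<in> borel_measurable M" "\<And>x. cmod (f x) \<le> cmod (g x)" "0 \<le> p"
  shows "f \<in> Lp_space M p"
proof -
  have "(\<integral>\<^sup>+ x. ennreal (cmod (f x) powr p) \<partial>M) \<le> (\<integral>\<^sup>+ x. ennreal (cmod (g x) powr p) \<partial>M)"
    using assms by (intro nn_integral_mono ennreal_leI powr_mono2) auto
  then show ?thesis using assms by (auto simp: Lp_space_iff)
qed

lemma zero_in_Lp_space: "(\<lambda>x. 0) \<in> Lp_space M p"
  by (simp add: Lp_space_iff)

text \<open>Young's inequality for \<open>u / U\<close> and \<open>v / V\<close>, integrated.
  \<open>U\<close> and \<open>V\<close> are any positive upper bounds of the two norms, so vanishing
  norms need no separate case.\<close>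

lemma nn_integral_Hoelder:
  fixes u v :: "'a \<Rightarrow> real"
  assumes [measurable]: "u \<in> borel_measurable M" "v \<in> borel_measurable M"
    and nn: "\<And>x. 0 \<le> u x" "\<And>x. 0 \<le> v x"
    and pq: "1 < p" "1 < q" "1 / p + 1 / q = 1"
    and UV: "0 < U" "0 < V"
    and u: "(\<integral>\<^sup>+ x. ennreal (u x powr p) \<partial>M) \<le> ennreal (U powr p)"
    and v: "(\<integral>\<^sup>+ x. ennreal (v x powr q) \<partial>M) \<le> ennreal (V powr q)"
  shows "(\<integral>\<^sup>+ x. ennreal (u x * v x) \<partial>M) \<le> ennreal (U * V)"
proof -
  \<comment> \<open>The coefficients of Young's inequality after multiplication by
    \<open>U * V\<close>; the bounds \<open>U powr p\<close> and \<open>V powr q\<close> then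
    cancel, leaving \<open>U * V * (1 / p + 1 / q)\<close>.\<close>
  define cu where "cu = U * V / (p * U powr p)"
  define cv where "cv = U * V / (q * V powr q)"
  have c: "0 \<le> cu" "0 \<le> cv" using pq UV by (auto simp: cu_def cv_def)
  have "u x * v x \<le> cu * u x powr p + cv * v x powr q" for x
  proof -
    have "(u x / U) * (v x / V) \<le> (u x / U) powr p / p + (v x / V) powr q / q"
      using nn UV pq by (intro Youngs_inequality) auto
    then have "U * V * ((u x / U) * (v x / V)) \<le> U * V * ((u x / U) powr p / p + (v x / V) powr q / q)"
      using UV by (intro mult_left_mono) auto
    then show ?thesis
      using UV nn by (simp add: cu_def cv_def powr_divide field_simps)
  qed
  then have "(\<integral>\<^sup>+ x. ennreal (u x * v x) \<partial>M)
      \<le> (\<integral>\<^sup>+ x. ennreal cu * ennreal (u x powr p) + ennreal cv * ennreal (v x powr q) \<partial>M)"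
    using c by (intro nn_integral_mono) (simp flip: ennreal_plus ennreal_mult)
  also have "\<dots> \<le> ennreal cu * ennreal (U powr p) + ennreal cv * ennreal (V powr q)"
    using u v by (simp add: nn_integral_add nn_integral_cmult add_mono mult_left_mono)
  also have "\<dots> = ennreal (U * V * (1 / p + 1 / q))"
    using c UV pq by (simp add: cu_def cv_def field_simps flip: ennreal_plus ennreal_mult)
  finally show ?thesis using pq by simp
qed

section \<open>Extension and interpolation of the transform\<close>

text \<open>Interpolation uses only these two endpoint bounds, so the measure stays abstract.
  \<open>C\<close> is taken positive because truncation heights and error bounds divide by
  it.\<close>

locale L1_L2_bounded_transform =
  fixes M :: "'a measure" and F :: "('a \<Rightarrow> complex) \<Rightarrow> 'a \<Rightarrow> complex" and C :: real
  assumes unitary: "unitary_L2 M F"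
    and C_pos: "0 < C"
    and L1_bound: "f \<in> Lp_space M 1 \<Longrightarrow> f \<in> Lp_space M 2 \<Longrightarrow>
      Linf_norm M (F f) \<le> ennreal C * Lp_norm M 1 f"
begin

lemma F_L2: "f \<in> Lp_space M 2 \<Longrightarrow> F f \<in> Lp_space M 2"
  and F_add: "f \<in> Lp_space M 2 \<Longrightarrow> g \<in> Lp_space M 2 \<Longrightarrow>
    AE x in M. F (\<lambda>y. f y + g y) x = F f x + F g x"
  and F_cmult: "f \<in> Lp_space M 2 \<Longrightarrow> AE x in M. F (\<lambda>y. c * f y) x = c * F f x"
  and F_isometry: "f \<in> Lp_space M 2 \<Longrightarrow> Lp_norm M 2 (F f) = Lp_norm M 2 f"
  using unitary by (auto simp: unitary_L2_def)

lemma F_measurable: "f \<in> Lp_space M 2 \<Longrightarrow> F f \<in> borel_measurable M"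
  using F_L2 by (auto simp: Lp_space_iff)

lemma F_diff:
  assumes "f \<in> Lp_space M 2" "g \<in> Lp_space M 2"
  shows "AE x in M. F (\<lambda>y. f y - g y) x = F f x - F g x"
  using F_add[OF assms(1) Lp_space_cmult[OF assms(2), of "-1"]] F_cmult[OF assms(2), of "-1"]
  by eventually_elim simp

lemma F_zero: "AE x in M. F (\<lambda>x. 0) x = 0"
  using F_cmult[of "\<lambda>x. 0" 0] by (simp add: zero_in_Lp_space)

lemma F_AE_bound:
  assumes "f \<in> Lp_space M 1" "f \<in> Lp_space M 2"
  shows "AE x in M. ennreal (cmod (F f x)) \<le> ennreal C * (\<integral>\<^sup>+ x. ennreal (cmod (f x)) \<partial>M)"
  using esssup_AE[of "\<lambda>x. ennreal (cmod (F f x))" M] L1_bound[OF assms]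
  by (auto simp: Linf_norm_def Lp_norm_1)

text \<open>Uniqueness and the \<open>L\<^sup>1\<close>--\<open>L\<^sup>\<infinity>\<close> bound of the extension in one statement: only the difference
  of the two arguments needs to be integrable.\<close>

lemma extension_value_diff_bound:
  assumes fG: "extension_value M F f G" and fG': "extension_value M F f' G'"
    and [measurable]: "f \<in> borel_measurable M" "f' \<in> borel_measurable M"
    and K: "(\<integral>\<^sup>+ x. ennreal (cmod (f x - f' x)) \<partial>M) \<le> ennreal K" and "0 \<le> K"
  shows "AE x in M. cmod (G x - G' x) \<le> C * K"
proof -
  obtain f1 f2 g1 h where f: "f1 \<in> Lp_space M 1" "f2 \<in> Lp_space M 2" "g1 \<in> borel_measurable M"
      "AE x in M. f x = f1 x + f2 x" "\<And>n. h n \<in> Lp_space M 1" "\<And>n. h n \<in> Lp_space M 2"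
      "(\<lambda>n. Lp_norm M 1 (\<lambda>x. h n x - f1 x)) \<longlonglongrightarrow> 0"
      "(\<lambda>n. Linf_norm M (\<lambda>x. F (h n) x - g1 x)) \<longlonglongrightarrow> 0"
      "AE x in M. G x = g1 x + F f2 x"
    using fG unfolding extension_value_def by blast
  obtain f1' f2' g1' h' where f': "f1' \<in> Lp_space M 1" "f2' \<in> Lp_space M 2" "g1' \<in> borel_measurable M"
      "AE x in M. f' x = f1' x + f2' x" "\<And>n. h' n \<in> Lp_space M 1" "\<And>n. h' n \<in> Lp_space M 2"
      "(\<lambda>n. Lp_norm M 1 (\<lambda>x. h' n x - f1' x)) \<longlonglongrightarrow> 0"
      "(\<lambda>n. Linf_norm M (\<lambda>x. F (h' n) x - g1' x)) \<longlonglongrightarrow> 0"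
      "AE x in M. G' x = g1' x + F f2' x"
    using fG' unfolding extension_value_def by blast
  have [measurable]: "f1 \<in> borel_measurable M" "f2 \<in> borel_measurable M" "h n \<in> borel_measurable M"
    "f1' \<in> borel_measurable M" "f2' \<in> borel_measurable M" "h' n \<in> borel_measurable M" for n
    using f f' by (auto simp: Lp_space_iff)
  \<comment> \<open>The mismatch of the L^2 parts. Almost everywhere it equals
    \<open>(f1 - f1') - (f - f')\<close>, hence it is integrable too and lies in the intersection on
    which the L^1 bound for \<open>F\<close> is available.\<close>
  define d where "d = (\<lambda>x. f2' x - f2 x)"
  have d2: "d \<in> Lp_space M 2"
    unfolding d_def using f f' by (intro Lp_space_diff) auto
  have [measurable]: "d \<in> borel_measurable M" by (simp add: d_def)
  have d_eq: "AE x in M. f x - f' x = f1 x - f1' x - d x"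
    using f(4) f'(4) by eventually_elim (simp add: d_def)
  have d1: "d \<in> Lp_space M 1"
  proof -
    have "(\<lambda>x. f x - f' x) \<in> Lp_space M 1"
      using K by (auto simp: Lp_space_1_iff intro: le_less_trans)
    from Lp_space_diff[OF Lp_space_diff[OF f(1) f'(1)] this]
    have "(\<lambda>x. (f1 x - f1' x) - (f x - f' x)) \<in> Lp_space M 1"
      by simp
    moreover have "(\<integral>\<^sup>+ x. ennreal (cmod (d x)) \<partial>M)
        = (\<integral>\<^sup>+ x. ennreal (cmod ((f1 x - f1' x) - (f x - f' x))) \<partial>M)"
      using d_eq by (intro nn_integral_cong_AE) (auto elim!: eventually_mono)
    ultimately show ?thesis by (simp add: Lp_space_1_iff)
  qed
  \<comment> \<open>In L^1 these functions tend to \<open>f - f'\<close>, and their transforms tend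
    uniformly, off a null set, to \<open>G - G'\<close>. The bound for \<open>F\<close> on
    \<open>w n\<close> therefore passes to the limit.\<close>
  define w where "w n = (\<lambda>x. (h n x - h' n x) - d x)" for n
  define e where "e n = Lp_norm M 1 (\<lambda>x. h n x - f1 x)" for n
  define e' where "e' n = Lp_norm M 1 (\<lambda>x. h' n x - f1' x)" for n
  define l where "l n = Linf_norm M (\<lambda>x. F (h n) x - g1 x)" for n
  define l' where "l' n = Linf_norm M (\<lambda>x. F (h' n) x - g1' x)" for n
  have w1: "w n \<in> Lp_space M 1" and w2: "w n \<in> Lp_space M 2" for n
    unfolding w_def using f f' d1 d2 by (intro Lp_space_diff; auto)+
  have w_le: "(\<integral>\<^sup>+ x. ennreal (cmod (w n x)) \<partial>M) \<le> e n + e' n + ennreal K" for n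
  proof -
    have "AE x in M. cmod (w n x) \<le> cmod (h n x - f1 x) + cmod (h' n x - f1' x) + cmod (f x - f' x)"
      using d_eq
    proof eventually_elim
      case (elim x)
      have "w n x = (h n x - f1 x) - (h' n x - f1' x) + (f x - f' x)"
        unfolding elim by (simp add: w_def)
      then show ?case
        by (metis add_right_mono norm_triangle_ineq norm_triangle_ineq4 order_trans)
    qed
    then have "(\<integral>\<^sup>+ x. ennreal (cmod (w n x)) \<partial>M) \<le> (\<integral>\<^sup>+ x. ennreal (cmod (h n x - f1 x))
       + ennreal (cmod (h' n x - f1' x)) + ennreal (cmod (f x - f' x)) \<partial>M)"
      by (intro nn_integral_mono_AE) (auto elim!: eventually_mono simp flip: ennreal_plus)
    also have "\<dots> \<le> e n + e' n + ennreal K"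
      using K by (simp add: nn_integral_add e_def e'_def Lp_norm_1 add_mono)
    finally show ?thesis .
  qed
  \<comment> \<open>The quantifier over \<open>n\<close> stands inside, so that one null set serves
    for the limit in \<open>n\<close>.\<close>
  have "AE x in M. \<forall>n. ennreal (cmod (G x - G' x)) \<le> l n + l' n + ennreal C * (e n + e' n + ennreal K)"
  proof (subst AE_all_countable, intro allI)
    fix n
    have A1: "AE x in M. ennreal (cmod (F (h n) x - g1 x)) \<le> l n"
      unfolding l_def Linf_norm_def by (rule esssup_AE)
    have A2: "AE x in M. ennreal (cmod (F (h' n) x - g1' x)) \<le> l' n"
      unfolding l'_def Linf_norm_def by (rule esssup_AE)
    have A3: "AE x in M. F (w n) x = F (h n) x - F (h' n) x - (F f2' x - F f2 x)"
      using F_diff[OF Lp_space_diff[OF f(6)[of n] f'(6)[of n] zero_le_numeral] d2] F_diff[OF f(6)[of n] f'(6)[of n]]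
        F_diff[OF f'(2) f(2)]
      unfolding w_def d_def by eventually_elim simp
    have A4: "AE x in M. ennreal (cmod (F (w n) x)) \<le> ennreal C * (e n + e' n + ennreal K)"
      using F_AE_bound[OF w1[of n] w2[of n]]
      by eventually_elim (erule order_trans, intro mult_left_mono w_le, simp)
    show "AE x in M. ennreal (cmod (G x - G' x)) \<le> l n + l' n + ennreal C * (e n + e' n + ennreal K)"
      using A1 A2 A3 A4 f(9) f'(9)
    proof eventually_elim
      case (elim x)
      have "G x - G' x = F (w n) x - (F (h n) x - g1 x) + (F (h' n) x - g1' x)"
        using elim by simp
      then have "cmod (G x - G' x) \<le> cmod (F (h n) x - g1 x) + cmod (F (h' n) x - g1' x) + cmod (F (w n) x)"
        using norm_triangle_ineq[of "F (w n) x - (F (h n) x - g1 x)" "F (h' n) x - g1' x"]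
          norm_triangle_ineq4[of "F (w n) x" "F (h n) x - g1 x"] by simp
      then have "ennreal (cmod (G x - G' x)) \<le> ennreal (cmod (F (h n) x - g1 x))
          + ennreal (cmod (F (h' n) x - g1' x)) + ennreal (cmod (F (w n) x))"
        by (simp flip: ennreal_plus)
      also have "\<dots> \<le> l n + l' n + ennreal C * (e n + e' n + ennreal K)"
        using elim by (intro add_mono) auto
      finally show ?case .
    qed
  qed
  moreover have "(\<lambda>n. l n + l' n + ennreal C * (e n + e' n + ennreal K))
      \<longlonglongrightarrow> 0 + 0 + ennreal C * (0 + 0 + ennreal K)"
    using f(7,8) f'(7,8) unfolding e_def e'_def l_def l'_def
    by (intro tendsto_add ennreal_tendsto_cmult tendsto_const) auto
  ultimately have "AE x in M. ennreal (cmod (G x - G' x)) \<le> 0 + 0 + ennreal C * (0 + 0 + ennreal K)"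
    by (auto elim!: eventually_mono intro: LIMSEQ_le_const)
  then show ?thesis
    using C_pos \<open>0 \<le> K\<close> by (simp flip: ennreal_mult)
qed

section \<open>Existence of the extension, and its agreement with the transform on L^2\<close>

lemma extension_value_L2:
  assumes "v \<in> Lp_space M 2"
  shows "extension_value M F v (F v)"
proof -
  have 1: "AE x in M. ennreal (cmod (F (\<lambda>x. 0) x)) \<le> 0"
    using F_zero by eventually_elim simp
  have "Linf_norm M (F (\<lambda>x. 0)) \<le> 0"
    unfolding Linf_norm_def using F_measurable[OF zero_in_Lp_space] 1
    by (intro esssup_I) auto
  \<comment> \<open>The decomposition is \<open>0 + v\<close>, with the zero sequence approximating
    the L^1 part.\<close>
  then show ?thesis
    unfolding extension_value_def using assms F_measurable[OF assms]
    by (intro conjI bexI[of _ v] bexI[of _ "\<lambda>x. 0"] exI[of _ "\<lambda>n x. 0"])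
       (auto simp: zero_in_Lp_space Lp_norm_1)
qed

text \<open>Truncations of \<open>f1\<close> by height converge to it in L^1 and lie in L^2. By the
  L^1 bound their transforms form a uniform Cauchy sequence off a null set, and its limit serves as
  the transform of \<open>f1\<close>.\<close>

lemma extension_value_exists:
  assumes f1: "f1 \<in> Lp_space M 1" and f2: "f2 \<in> Lp_space M 2"
    and f: "\<And>x. f x = f1 x + f2 x"
  shows "\<exists>g. extension_value M F f g"
proof -
  have [measurable]: "f1 \<in> borel_measurable M"
    using f1 by (auto simp: Lp_space_iff)
  define h where "h n x = (if cmod (f1 x) \<le> real n then f1 x else 0)" for n :: nat and x
  have [measurable]: "h n \<in> borel_measurable M" for n
    unfolding h_def by measurable
  have h1: "h n \<in> Lp_space M 1" for n
    by (rule Lp_space_mono[OF f1]) (auto simp: h_def)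
  have h2: "h n \<in> Lp_space M 2" for n
  proof -
    \<comment> \<open>A bounded integrable function is square integrable.\<close>
    have "cmod (h n x) powr 2 \<le> real n * cmod (f1 x)" for x
      by (auto simp: h_def power2_eq_square mult_right_mono)
    then have "(\<integral>\<^sup>+ x. ennreal (cmod (h n x) powr 2) \<partial>M)
        \<le> (\<integral>\<^sup>+ x. ennreal (real n) * ennreal (cmod (f1 x)) \<partial>M)"
      by (intro nn_integral_mono) (simp flip: ennreal_mult)
    also have "\<dots> < \<infinity>"
      using f1 by (simp add: nn_integral_cmult Lp_space_1_iff ennreal_mult_less_top)
    finally show ?thesis by (simp add: Lp_space_iff)
  qed
  have [measurable]: "F (h n) \<in> borel_measurable M" for n
    by (rule F_measurable[OF h2])
  define e where "e n = enn2real (\<integral>\<^sup>+ x. ennreal (cmod (h n x - f1 x)) \<partial>M)" for n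
  have lim0: "(\<lambda>n. \<integral>\<^sup>+ x. ennreal (cmod (h n x - f1 x)) \<partial>M) \<longlonglongrightarrow> (\<integral>\<^sup>+ x. 0 \<partial>M)"
  proof (rule nn_integral_dominated_convergence[where w = "\<lambda>x. ennreal (cmod (f1 x))"])
    have "eventually (\<lambda>n. ennreal (cmod (h n x - f1 x)) = 0) sequentially" for x
      using eventually_ge_at_top[of "nat \<lceil>cmod (f1 x)\<rceil>"]
      by eventually_elim (simp add: h_def nat_le_iff ceiling_le_iff)
    then show "AE x in M. (\<lambda>n. ennreal (cmod (h n x - f1 x))) \<longlonglongrightarrow> 0"
      by (simp add: tendsto_eventually)
  qed (use f1 in \<open>auto simp: h_def Lp_space_1_iff\<close>)
  have fin: "(\<integral>\<^sup>+ x. ennreal (cmod (h n x - f1 x)) \<partial>M) < \<infinity>" for n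
    using Lp_space_diff[OF h1 f1] by (simp add: Lp_space_1_iff)
  have e_eq: "(\<integral>\<^sup>+ x. ennreal (cmod (h n x - f1 x)) \<partial>M) = ennreal (e n)" for n
    using fin[of n] by (simp add: e_def)
  have e_nn: "0 \<le> e n" for n by (simp add: e_def)
  have e0: "e \<longlonglongrightarrow> 0"
    using lim0 unfolding e_eq by (intro tendsto_ennrealD) (simp_all add: e_nn)
  \<comment> \<open>Both transforms are extension values, so the bound for differences applies;
    countably many pairs share one null set.\<close>
  have Fh: "AE x in M. \<forall>n m. cmod (F (h n) x - F (h m) x) \<le> C * (e n + e m)"
  proof (simp only: AE_all_countable, intro allI)
    fix n m
    have "(\<integral>\<^sup>+ x. ennreal (cmod (h n x - h m x)) \<partial>M)
        \<le> (\<integral>\<^sup>+ x. ennreal (cmod (h n x - f1 x)) + ennreal (cmod (h m x - f1 x)) \<partial>M)"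
      by (intro nn_integral_mono)
         (simp add: norm_triangle_ineq4 dist_triangle2 flip: ennreal_plus dist_norm)
    also have "\<dots> = ennreal (e n + e m)"
      by (simp add: nn_integral_add e_eq e_nn)
    finally have "(\<integral>\<^sup>+ x. ennreal (cmod (h n x - h m x)) \<partial>M) \<le> ennreal (e n + e m)" .
    from extension_value_diff_bound[OF extension_value_L2[OF h2] extension_value_L2[OF h2] _ _ this]
    show "AE x in M. cmod (F (h n) x - F (h m) x) \<le> C * (e n + e m)"
      using e_nn by simp
  qed
  \<comment> \<open>Where the sequence diverges this value is arbitrary; that happens only on a null
    set.\<close>
  define g1 where "g1 x = lim (\<lambda>n. F (h n) x)" for x
  have g1[measurable]: "g1 \<in> borel_measurable M"
    unfolding g1_def by measurable
  have Fg: "AE x in M. \<forall>n. cmod (F (h n) x - g1 x) \<le> C * e n"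
    using Fh
  proof eventually_elim
    case (elim x)
    have "Cauchy (\<lambda>n. F (h n) x)"
    proof (rule CauchyI)
      fix r :: real assume "0 < r"
      then have "eventually (\<lambda>n. e n < r / (2 * C)) sequentially"
        using order_tendstoD(2)[OF e0, of "r / (2 * C)"] C_pos by auto
      then obtain k where k: "\<And>n. n \<ge> k \<Longrightarrow> e n < r / (2 * C)"
        by (auto simp: eventually_sequentially)
      have "cmod (F (h m) x - F (h n) x) < r" if "k \<le> m" "k \<le> n" for m n
      proof -
        have "C * (e m + e n) < C * (r / (2 * C) + r / (2 * C))"
          using k[OF that(1)] k[OF that(2)] C_pos by (intro mult_strict_left_mono add_strict_mono)
        also have "\<dots> = r" using C_pos by simp
        finally show ?thesis using elim[rule_format, of m n] by linarith
      qed
      then show "\<exists>k. \<forall>m\<ge>k. \<forall>n\<ge>k. norm (F (h m) x - F (h n) x) < r" by blast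
    qed
    then have lim: "(\<lambda>n. F (h n) x) \<longlonglongrightarrow> g1 x"
      unfolding g1_def by (simp add: Cauchy_convergent_iff convergent_LIMSEQ_iff)
    \<comment> \<open>Let \<open>m\<close> tend to infinity in the Cauchy estimate;
      \<open>e m\<close> tends to 0.\<close>
    show ?case
    proof
      fix n
      have 1: "(\<lambda>m. cmod (F (h n) x - F (h m) x)) \<longlonglongrightarrow> cmod (F (h n) x - g1 x)"
        by (intro tendsto_intros lim)
      have 2: "(\<lambda>m. C * (e n + e m)) \<longlonglongrightarrow> C * (e n + 0)"
        by (intro tendsto_intros e0)
      show "cmod (F (h n) x - g1 x) \<le> C * e n"
        using LIMSEQ_le[OF 1 2] elim by auto
    qed
  qed
  have "(\<lambda>n. Linf_norm M (\<lambda>x. F (h n) x - g1 x)) \<longlonglongrightarrow> 0"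
  proof (rule tendsto_sandwich[OF _ _ tendsto_const])
    show "(\<lambda>n. ennreal (C * e n)) \<longlonglongrightarrow> 0"
      using tendsto_mult_right_zero[OF e0, of C] by (intro tendsto_ennrealI[where x = 0, simplified])
    have "Linf_norm M (\<lambda>x. F (h n) x - g1 x) \<le> ennreal (C * e n)" for n
      unfolding Linf_norm_def using Fg
      by (intro esssup_I) (auto elim!: eventually_mono intro!: ennreal_leI)
    then show "\<forall>\<^sub>F n in sequentially. Linf_norm M (\<lambda>x. F (h n) x - g1 x) \<le> ennreal (C * e n)"
      by simp
  qed simp
  moreover have "(\<lambda>n. Lp_norm M 1 (\<lambda>x. h n x - f1 x)) \<longlonglongrightarrow> 0"
    using lim0 by (simp add: Lp_norm_1)
  ultimately have "extension_value M F f (\<lambda>x. g1 x + F f2 x)"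
    unfolding extension_value_def using f1 f2 h1 h2 F_measurable[OF f2]
    by (intro conjI bexI[of _ f1] bexI[of _ f2] bexI[of _ g1] exI[of _ h]) (auto simp: f)
  then show ?thesis by blast
qed

text \<open>Splitting at height 1 puts L^p into L^1 + L^2: where the modulus exceeds 1 it is at most
  its \<open>p\<close>-th power, and elsewhere its square is. Existence then makes the choice in
  \<open>extend\<close> a genuine value.\<close>

lemma extension_value_extend:
  assumes f: "f \<in> Lp_space M p" and p: "1 \<le> p" "p \<le> 2"
  shows "extension_value M F f (extend M F f)"
proof -
  have [measurable]: "f \<in> borel_measurable M" using f by (auto simp: Lp_space_iff)
  define f1 where "f1 x = (if cmod (f x) > 1 then f x else 0)" for x
  define f2 where "f2 x = (if cmod (f x) > 1 then 0 else f x)" for x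
  have [measurable]: "f1 \<in> borel_measurable M" "f2 \<in> borel_measurable M"
    unfolding f1_def f2_def by measurable
  have "cmod (f1 x) \<le> cmod (f x) powr p" for x
    using powr_mono[of 1 p "cmod (f x)"] p by (auto simp: f1_def)
  then have "(\<integral>\<^sup>+ x. ennreal (cmod (f1 x)) \<partial>M) \<le> (\<integral>\<^sup>+ x. ennreal (cmod (f x) powr p) \<partial>M)"
    by (intro nn_integral_mono ennreal_leI)
  then have f1: "f1 \<in> Lp_space M 1"
    using f by (auto simp: Lp_space_1_iff Lp_space_iff[of _ _ p])
  have "cmod (f2 x) powr 2 \<le> cmod (f x) powr p" for x
    using powr_mono'[of p 2 "cmod (f x)"] p by (auto simp: f2_def simp del: powr_numeral)
  then have "(\<integral>\<^sup>+ x. ennreal (cmod (f2 x) powr 2) \<partial>M) \<le> (\<integral>\<^sup>+ x. ennreal (cmod (f x) powr p) \<partial>M)"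
    by (intro nn_integral_mono ennreal_leI)
  then have f2: "f2 \<in> Lp_space M 2"
    using f by (auto simp: Lp_space_iff)
  have "f x = f1 x + f2 x" for x by (simp add: f1_def f2_def)
  from extension_value_exists[OF f1 f2 this] show ?thesis
    unfolding extend_def by (rule someI_ex)
qed

end

section \<open>Distribution functions and Marcinkiewicz interpolation\<close>

lemma nn_integral_powr_from_0:
  fixes r c :: real
  assumes "-1 < r" "0 \<le> c"
  shows "(\<integral>\<^sup>+ x. ennreal (x powr r) * indicator {0..c} x \<partial>lborel) = ennreal (c powr (r + 1) / (r + 1))"
  by (rule nn_integral_has_integral_lebesgue') (use has_integral_powr_from_0[OF assms] in auto)

text \<open>Write \<open>g x powr q\<close> as the integral of \<open>q * t powr (q - 1)\<close>
  over \<open>0 < t < g x\<close> and exchange the integrals, for which the measure has to be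
  sigma-finite.\<close>

lemma (in sigma_finite_measure) nn_integral_powr_layer_cake:
  fixes g :: "'a \<Rightarrow> real" and q :: real
  assumes [measurable]: "g \<in> borel_measurable M" and nn: "\<And>x. 0 \<le> g x" and q: "0 < q"
  shows "(\<integral>\<^sup>+ x. ennreal (g x powr q) \<partial>M) =
    (\<integral>\<^sup>+ t. ennreal (q * t powr (q - 1)) * indicator {0<..} t * emeasure M {x \<in> space M. t < g x} \<partial>lborel)"
proof -
  interpret P: pair_sigma_finite M lborel
    by (intro pair_sigma_finite.intro sigma_finite_measure_axioms lborel.sigma_finite_measure_axioms)
  have "ennreal (g x powr q) = (\<integral>\<^sup>+ t. ennreal (q * t powr (q - 1)) * indicator {0<..} t
      * indicator {t. t < g x} t \<partial>lborel)" for x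
  proof -
    have "ennreal (g x powr q) = ennreal q * ennreal (g x powr (q - 1 + 1) / (q - 1 + 1))"
      using q by (simp flip: ennreal_mult)
    also have "\<dots> = ennreal q * (\<integral>\<^sup>+ t. ennreal (t powr (q - 1)) * indicator {0..g x} t \<partial>lborel)"
      using q nn by (subst nn_integral_powr_from_0) auto
    also have "\<dots> = (\<integral>\<^sup>+ t. ennreal q * (ennreal (t powr (q - 1)) * indicator {0..g x} t) \<partial>lborel)"
      by (simp add: nn_integral_cmult)
    also have "\<dots> = (\<integral>\<^sup>+ t. ennreal (q * t powr (q - 1)) * indicator {0<..} t
      * indicator {t. t < g x} t \<partial>lborel)"
    proof (rule nn_integral_cong_AE)
      show "AE t in lborel. ennreal q * (ennreal (t powr (q - 1)) * indicator {0..g x} t) =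
          ennreal (q * t powr (q - 1)) * indicator {0<..} t * indicator {t. t < g x} t"
        using AE_lborel_singleton[of 0] AE_lborel_singleton[of "g x"]
        by eventually_elim (use q in \<open>auto simp: indicator_def ennreal_mult\<close>)
    qed
    finally show ?thesis .
  qed
  then have "(\<integral>\<^sup>+ x. ennreal (g x powr q) \<partial>M) =
    (\<integral>\<^sup>+ x. \<integral>\<^sup>+ t. ennreal (q * t powr (q - 1)) * indicator {0<..} t * indicator {t. t < g x} t \<partial>lborel \<partial>M)"
    by simp
  also have "\<dots> = (\<integral>\<^sup>+ t. \<integral>\<^sup>+ x. ennreal (q * t powr (q - 1)) * indicator {0<..} t
      * indicator {t. t < g x} t \<partial>M \<partial>lborel)"
    by (rule P.Fubini'[symmetric]) measurable
  also have "\<dots> = (\<integral>\<^sup>+ t. ennreal (q * t powr (q - 1)) * indicator {0<..} t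
      * emeasure M {x \<in> space M. t < g x} \<partial>lborel)"
  proof (rule nn_integral_cong)
    fix t :: real
    have "(\<integral>\<^sup>+ x. ennreal (q * t powr (q - 1)) * indicator {0<..} t * indicator {t. t < g x} t \<partial>M)
       = (\<integral>\<^sup>+ x. ennreal (q * t powr (q - 1)) * indicator {0<..} t
            * indicator {x \<in> space M. t < g x} x \<partial>M)"
      by (rule nn_integral_cong) (simp add: indicator_def)
    also have "\<dots> = ennreal (q * t powr (q - 1)) * indicator {0<..} t
      * emeasure M {x \<in> space M. t < g x}"
      by (subst nn_integral_cmult) auto
    finally show "(\<integral>\<^sup>+ x. ennreal (q * t powr (q - 1)) * indicator {0<..} t * indicator {t. t < g x} t \<partial>M)
       = ennreal (q * t powr (q - 1)) * indicator {0<..} t * emeasure M {x \<in> space M. t < g x}" .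
  qed
  finally show ?thesis .
qed

context L1_L2_bounded_transform
begin

text \<open>The truncation height depends on \<open>t\<close> so that the large part of \<open>f\<close> contributes at most
  \<open>t / 2\<close> to the transform everywhere.\<close>

lemma extension_value_distribution:
  assumes fG: "extension_value M F f G" and f: "f \<in> Lp_space M p" and p: "1 < p" "p \<le> 2"
    and E: "(\<integral>\<^sup>+ x. ennreal (cmod (f x) powr p) \<partial>M) = ennreal E" "0 < E" and t: "0 < t"
  shows "emeasure M {x \<in> space M. t < cmod (G x)}
    \<le> ennreal (4 / t\<^sup>2) * (\<integral>\<^sup>+ x. ennreal ((cmod (f x))\<^sup>2)
        * indicator {x. t * cmod (f x) powr (p - 1) \<le> 2 * C * E} x \<partial>M)"
proof -
  have [measurable]: "f \<in> borel_measurable M" "G \<in> borel_measurable M"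
    using f fG by (auto simp: Lp_space_iff extension_value_def)
  \<comment> \<open>The small part of \<open>f\<close>. Where it is cut off,
    \<open>cmod (f x)\<close> is at most \<open>t / (2 * C * E) * cmod (f x) powr p\<close>, so the
    removed part has L^1 norm at most \<open>t / (2 * C)\<close> and \<open>F\<close> sends that to
    at most \<open>t / 2\<close>.\<close>
  define v where "v x = (if t * cmod (f x) powr (p - 1) \<le> 2 * C * E then f x else 0)" for x
  have [measurable]: "v \<in> borel_measurable M" unfolding v_def by measurable
  \<comment> \<open>An upper bound for \<open>cmod (f x) powr (2 - p)\<close> where \<open>f\<close>
    is kept; it reduces the square to the \<open>p\<close>-th power.\<close>
  define b where "b = (2 * C * E / t) powr ((2 - p) / (p - 1))"
  have v2: "v \<in> Lp_space M 2"
  proof -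
    have "cmod (v x) powr 2 \<le> b * cmod (f x) powr p" for x
    proof (cases "t * cmod (f x) powr (p - 1) \<le> 2 * C * E")
      case True
      have "cmod (f x) powr (2 - p) = (cmod (f x) powr (p - 1)) powr ((2 - p) / (p - 1))"
        using p by (simp add: powr_powr)
      also have "\<dots> \<le> b"
        unfolding b_def using True t p by (intro powr_mono2) (auto simp: field_simps)
      finally have "cmod (f x) powr (2 - p) * cmod (f x) powr p \<le> b * cmod (f x) powr p"
        by (intro mult_right_mono) auto
      then show ?thesis using True by (simp add: v_def flip: powr_add)
    qed (simp add: v_def b_def)
    then have "(\<integral>\<^sup>+ x. ennreal (cmod (v x) powr 2) \<partial>M)
        \<le> (\<integral>\<^sup>+ x. ennreal b * ennreal (cmod (f x) powr p) \<partial>M)"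
      by (intro nn_integral_mono) (simp add: b_def flip: ennreal_mult)
    also have "\<dots> < \<infinity>" by (simp add: nn_integral_cmult E ennreal_mult_less_top)
    finally show ?thesis by (simp add: Lp_space_iff)
  qed
  have [measurable]: "F v \<in> borel_measurable M" by (rule F_measurable[OF v2])
  have "cmod (f x - v x) \<le> t / (2 * C * E) * cmod (f x) powr p" for x
  proof (cases "t * cmod (f x) powr (p - 1) \<le> 2 * C * E")
    case False
    then have "1 * cmod (f x) \<le> (t / (2 * C * E) * cmod (f x) powr (p - 1)) * cmod (f x)"
      using C_pos E by (intro mult_right_mono) (auto simp: field_simps)
    moreover have "cmod (f x) powr (p - 1) * cmod (f x) = cmod (f x) powr p"
      by (simp add: powr_mult_base' powr_diff)
    ultimately show ?thesis using False by (simp add: v_def mult.assoc)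
  qed (use C_pos E t in \<open>simp add: v_def\<close>)
  then have "(\<integral>\<^sup>+ x. ennreal (cmod (f x - v x)) \<partial>M)
      \<le> (\<integral>\<^sup>+ x. ennreal (t / (2 * C * E)) * ennreal (cmod (f x) powr p) \<partial>M)"
    using C_pos E t by (intro nn_integral_mono) (simp flip: ennreal_mult)
  also have "\<dots> = ennreal (t / (2 * C))"
    using C_pos E t by (subst nn_integral_cmult) (simp_all flip: ennreal_mult)
  finally have "(\<integral>\<^sup>+ x. ennreal (cmod (f x - v x)) \<partial>M) \<le> ennreal (t / (2 * C))" .
  from extension_value_diff_bound[OF fG extension_value_L2[OF v2] _ _ this]
  have GF: "AE x in M. cmod (G x - F v x) \<le> t / 2"
    using C_pos t by simp
  have "emeasure M {x \<in> space M. t < cmod (G x)} = (\<integral>\<^sup>+ x. indicator {x \<in> space M. t < cmod (G x)} x \<partial>M)"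
    by simp
  \<comment> \<open>Chebyshev's inequality: where \<open>G\<close> exceeds \<open>t\<close>, the
    transform of the small part is at least \<open>t / 2\<close>.\<close>
  also have "\<dots> \<le> (\<integral>\<^sup>+ x. ennreal (4 / t\<^sup>2) * ennreal (cmod (F v x) powr 2) \<partial>M)"
  proof (rule nn_integral_mono_AE)
    show "AE x in M. indicator {x \<in> space M. t < cmod (G x)} x
        \<le> ennreal (4 / t\<^sup>2) * ennreal (cmod (F v x) powr 2)"
      using GF
    proof eventually_elim
      case (elim x)
      show ?case
      proof (cases "t < cmod (G x)")
        case True
        then have "t / 2 \<le> cmod (F v x)"
          using elim norm_triangle_ineq2[of "G x" "F v x"] by simp
        then have "(t / 2)\<^sup>2 \<le> (cmod (F v x))\<^sup>2"
          using t by (intro power_mono) auto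
        then have "1 \<le> 4 / t\<^sup>2 * (cmod (F v x))\<^sup>2"
          using t by (simp add: field_simps)
        then show ?thesis by (simp add: indicator_def flip: ennreal_mult)
      qed simp
    qed
  qed
  also have "\<dots> = ennreal (4 / t\<^sup>2) * (\<integral>\<^sup>+ x. ennreal (cmod (F v x) powr 2) \<partial>M)"
    by (simp add: nn_integral_cmult)
  also have "(\<integral>\<^sup>+ x. ennreal (cmod (F v x) powr 2) \<partial>M) = (\<integral>\<^sup>+ x. ennreal (cmod (v x) powr 2) \<partial>M)"
  proof -
    have "Lp_norm M 2 (F v) = Lp_norm M 2 v" by (rule F_isometry[OF v2])
    moreover have "Lp_norm M 2 v < \<infinity>" using v2 by (simp add: Lp_space_def)
    ultimately obtain B where "0 \<le> B" "Lp_norm M 2 (F v) = ennreal B" "Lp_norm M 2 v = ennreal B"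
      by (cases "Lp_norm M 2 v") auto
    then show ?thesis using Lp_norm_eq_ennrealD[of M 2 v B] Lp_norm_eq_ennrealD[of M 2 "F v" B] by simp
  qed
  also have "\<dots> = (\<integral>\<^sup>+ x. ennreal ((cmod (f x))\<^sup>2)
        * indicator {x. t * cmod (f x) powr (p - 1) \<le> 2 * C * E} x \<partial>M)"
    by (intro nn_integral_cong) (simp add: v_def indicator_def)
  finally show ?thesis .
qed

text \<open>Comparison with \<open>F\<close> at the zero function. This settles the degenerate
  cases, in which a norm of the argument vanishes.\<close>

lemma extension_value_zero:
  assumes "extension_value M F f G" "f \<in> borel_measurable M" "AE x in M. f x = 0"
  shows "AE x in M. G x = 0"
proof -
  have "(\<integral>\<^sup>+ x. ennreal (cmod (f x - 0)) \<partial>M) = 0"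
    using assms(2,3) by (simp add: nn_integral_0_iff_AE)
  then have "AE x in M. cmod (G x - F (\<lambda>x. 0) x) \<le> C * 0"
    by (intro extension_value_diff_bound[OF assms(1) extension_value_L2[OF zero_in_Lp_space]])
       (use assms(2) in auto)
  then show ?thesis using F_zero by eventually_elim simp
qed

text \<open>The distribution bound goes into the layer-cake formula, and the integration in
  \<open>t\<close> is done first. Since \<open>q - 1 = q / p\<close>, the right side is the
  \<open>q\<close>-th power of the L^p norm up to the constant.\<close>

lemma hausdorff_young:
  assumes "sigma_finite_measure M" and p: "1 < p" "p \<le> 2" and q: "q = p / (p - 1)"
  obtains H where "0 < H"
    "\<And>f E. f \<in> Lp_space M p \<Longrightarrow> 0 \<le> E \<Longrightarrow>
       (\<integral>\<^sup>+ x. ennreal (cmod (f x) powr p) \<partial>M) = ennreal E \<Longrightarrow>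
       (\<integral>\<^sup>+ x. ennreal (cmod (extend M F f x) powr q) \<partial>M) \<le> ennreal (H * E powr (q - 1))"
proof (cases "p = 2")
  \<comment> \<open>At \<open>p = 2\<close> the integrand \<open>t powr (q - 3)\<close> below would
    be \<open>1 / t\<close>, which diverges at 0; the isometry replaces the interpolation.\<close>
  case True
  then have q2: "q = 2" using q by simp
  have "(\<integral>\<^sup>+ x. ennreal (cmod (extend M F f x) powr q) \<partial>M) \<le> ennreal (1 * E powr (q - 1))"
    if f: "f \<in> Lp_space M p" and E: "0 \<le> E" "(\<integral>\<^sup>+ x. ennreal (cmod (f x) powr p) \<partial>M) = ennreal E"
    for f E
  proof -
    have f2: "f \<in> Lp_space M 2" and [measurable]: "f \<in> borel_measurable M"
      using f True by (auto simp: Lp_space_iff)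
    have ext: "extension_value M F f (extend M F f)"
      by (rule extension_value_extend[OF f]) (use p in auto)
    \<comment> \<open>With equal arguments the difference bound is uniqueness of the
      extension.\<close>
    have "AE x in M. cmod (extend M F f x - F f x) \<le> C * 0"
      by (rule extension_value_diff_bound[OF ext extension_value_L2[OF f2]]) auto
    then have "(\<integral>\<^sup>+ x. ennreal (cmod (extend M F f x) powr q) \<partial>M) = (\<integral>\<^sup>+ x. ennreal (cmod (F f x) powr 2) \<partial>M)"
      by (intro nn_integral_cong_AE) (auto elim!: eventually_mono simp: q2)
    also have "\<dots> = ennreal (sqrt E powr 2)"
    proof -
      have "Lp_norm M 2 (F f) = ennreal (sqrt E)"
        using E unfolding F_isometry[OF f2] by (simp add: True Lp_norm_def ennpowr_ennreal powr_half_sqrt)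
      then show ?thesis using E by (intro Lp_norm_eq_ennrealD) auto
    qed
    finally show ?thesis using E by (simp add: q2)
  qed
  then show ?thesis by (intro that[of 1]) auto
next
  case False
  interpret sigma_finite_measure M by fact
  have p2: "p < 2" using False p by simp
  have q2: "2 < q" using p p2 by (simp add: q field_simps)
  have pq: "(p - 1) * (q - 2) = 2 - p" using p by (simp add: q field_simps)
  \<comment> \<open>What remains of \<open>4 * q\<close> times the integral of
    \<open>t powr (q - 3)\<close> over \<open>0 < t < L\<close>, with \<open>L\<close> as below,
    once the powers of \<open>E\<close> and \<open>cmod (f x)\<close> are taken out.\<close>
  define H where "H = 4 * q / (q - 2) * (2 * C) powr (q - 2)"
  have H: "0 < H" using q2 C_pos by (simp add: H_def)
  have "(\<integral>\<^sup>+ x. ennreal (cmod (extend M F f x) powr q) \<partial>M) \<le> ennreal (H * E powr (q - 1))"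
    if f: "f \<in> Lp_space M p" and E: "0 \<le> E" "(\<integral>\<^sup>+ x. ennreal (cmod (f x) powr p) \<partial>M) = ennreal E"
    for f E
  proof -
    define G where "G = extend M F f"
    have ext: "extension_value M F f G"
      unfolding G_def by (rule extension_value_extend[OF f]) (use p in auto)
    have [measurable]: "f \<in> borel_measurable M" "G \<in> borel_measurable M"
      using f ext by (auto simp: Lp_space_iff extension_value_def)
    show ?thesis
    proof (cases "E = 0")
      case True
      then have "AE x in M. f x = 0" using E by (simp add: nn_integral_0_iff_AE)
      then have "AE x in M. G x = 0" by (intro extension_value_zero[OF ext]) auto
      then have "(\<integral>\<^sup>+ x. ennreal (cmod (G x) powr q) \<partial>M) = 0"
        by (simp add: nn_integral_0_iff_AE)
      then show ?thesis by (simp add: G_def)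
    next
      case False
      then have E_pos: "0 < E" using E by simp
      interpret P: pair_sigma_finite M lborel
        by (intro pair_sigma_finite.intro sigma_finite_measure_axioms lborel.sigma_finite_measure_axioms)
      \<comment> \<open>The layer-cake weight \<open>q * t powr (q - 1)\<close> times the Chebyshev
        factor \<open>4 / t\<^sup>2\<close>.\<close>
      define k where "k t = ennreal (4 * q * t powr (q - 3)) * indicator {0<..} t" for t :: real
      have [measurable]: "k \<in> borel_measurable borel" unfolding k_def by measurable
      have "(\<integral>\<^sup>+ x. ennreal (cmod (G x) powr q) \<partial>M)
          = (\<integral>\<^sup>+ t. ennreal (q * t powr (q - 1)) * indicator {0<..} t
              * emeasure M {x \<in> space M. t < cmod (G x)} \<partial>lborel)"
        using q2 by (intro nn_integral_powr_layer_cake) auto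
      also have "\<dots> \<le> (\<integral>\<^sup>+ t. (\<integral>\<^sup>+ x. k t * (ennreal ((cmod (f x))\<^sup>2)
          * indicator {x. t * cmod (f x) powr (p - 1) \<le> 2 * C * E} x) \<partial>M) \<partial>lborel)"
      proof (rule nn_integral_mono)
        fix t :: real
        show "ennreal (q * t powr (q - 1)) * indicator {0<..} t * emeasure M {x \<in> space M. t < cmod (G x)}
          \<le> (\<integral>\<^sup>+ x. k t * (ennreal ((cmod (f x))\<^sup>2)
             * indicator {x. t * cmod (f x) powr (p - 1) \<le> 2 * C * E} x) \<partial>M)"
        proof (cases "0 < t")
          case True
          let ?I = "(\<integral>\<^sup>+ x. ennreal ((cmod (f x))\<^sup>2)
             * indicator {x. t * cmod (f x) powr (p - 1) \<le> 2 * C * E} x \<partial>M)"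
          have "t powr (q - 3) = t powr (q - 1) / t\<^sup>2"
            using True powr_diff[of t "q - 1" 2] by simp
          then have k: "k t = ennreal (q * t powr (q - 1)) * ennreal (4 / t\<^sup>2)"
            using True q2 by (simp add: k_def mult_ac flip: ennreal_mult)
          have "ennreal (q * t powr (q - 1)) * emeasure M {x \<in> space M. t < cmod (G x)}
              \<le> ennreal (q * t powr (q - 1)) * (ennreal (4 / t\<^sup>2) * ?I)"
            by (intro mult_left_mono extension_value_distribution[OF ext f p E(2) E_pos True]) auto
          also have "\<dots> = (\<integral>\<^sup>+ x. k t * (ennreal ((cmod (f x))\<^sup>2)
             * indicator {x. t * cmod (f x) powr (p - 1) \<le> 2 * C * E} x) \<partial>M)"
            by (simp add: nn_integral_cmult k mult.assoc)
          finally show ?thesis using True by simp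
        qed simp
      qed
      also have "\<dots> = (\<integral>\<^sup>+ x. (\<integral>\<^sup>+ t. k t * (ennreal ((cmod (f x))\<^sup>2)
          * indicator {x. t * cmod (f x) powr (p - 1) \<le> 2 * C * E} x) \<partial>lborel) \<partial>M)"
        by (rule P.Fubini') measurable
      also have "\<dots> \<le> (\<integral>\<^sup>+ x. ennreal (H * E powr (q - 2)) * ennreal (cmod (f x) powr p) \<partial>M)"
      proof (rule nn_integral_mono)
        fix x
        show "(\<integral>\<^sup>+ t. k t * (ennreal ((cmod (f x))\<^sup>2)
          * indicator {x. t * cmod (f x) powr (p - 1) \<le> 2 * C * E} x) \<partial>lborel)
          \<le> ennreal (H * E powr (q - 2)) * ennreal (cmod (f x) powr p)"
        proof (cases "f x = 0")
          case False
          define y where "y = cmod (f x)"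
          have y: "0 < y" using False by (simp add: y_def)
          \<comment> \<open>The largest level \<open>t\<close> at which the point \<open>x\<close>
            still belongs to the small part.\<close>
          define L where "L = 2 * C * E / y powr (p - 1)"
          have "(\<integral>\<^sup>+ t. k t * (ennreal (y\<^sup>2)
              * indicator {x. t * cmod (f x) powr (p - 1) \<le> 2 * C * E} x) \<partial>lborel)
            \<le> (\<integral>\<^sup>+ t. ennreal (4 * q * y\<^sup>2) * (ennreal (t powr (q - 3)) * indicator {0..L} t) \<partial>lborel)"
            using y q2 by (intro nn_integral_mono)
              (auto simp: k_def indicator_def L_def field_simps y_def simp flip: ennreal_mult)
          also have "\<dots> = ennreal (4 * q * y\<^sup>2) * ennreal (L powr (q - 3 + 1) / (q - 3 + 1))"
            using q2 y C_pos E by (simp add: nn_integral_cmult nn_integral_powr_from_0 L_def)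
          also have "\<dots> = ennreal (4 * q * y\<^sup>2 * (L powr (q - 2) / (q - 2)))"
            using q2 by (simp flip: ennreal_mult)
          \<comment> \<open>By \<open>pq\<close>, the power of \<open>y\<close> in the denominator
            of \<open>L powr (q - 2)\<close> is \<open>2 - p\<close>; against
            \<open>y\<^sup>2\<close> this leaves exactly \<open>y powr p\<close>.\<close>
          also have "4 * q * y\<^sup>2 * (L powr (q - 2) / (q - 2)) = H * E powr (q - 2) * y powr p"
          proof -
            have "L powr (q - 2) = (2 * C) powr (q - 2) * E powr (q - 2) / y powr (2 - p)"
              using C_pos E y by (simp add: L_def powr_divide powr_mult powr_powr pq)
            moreover have "y\<^sup>2 = y powr p * y powr (2 - p)"
              using y by (simp flip: powr_add)
            ultimately show ?thesis using y by (simp add: H_def field_simps)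
          qed
          finally show ?thesis
            using H by (simp add: y_def flip: ennreal_mult)
        qed simp
      qed
      also have "\<dots> = ennreal (H * E powr (q - 2) * E)"
        using H E by (subst nn_integral_cmult) (simp_all flip: ennreal_mult)
      also have "H * E powr (q - 2) * E = H * E powr (q - 1)"
        using E_pos powr_mult_base[of E "q - 2"] by (simp add: mult_ac)
      finally show ?thesis by (simp add: G_def)
    qed
  qed
  then show ?thesis using H that by blast
qed

end

section \<open>Integrals over balls\<close>

lemma dyadic_annulus_exists:
  fixes r y :: real
  assumes "0 < y" "y < r"
  shows "\<exists>j::nat. r / 2 ^ Suc j \<le> y \<and> y < r / 2 ^ j"
proof -
  obtain n where n: "(1 / 2 :: real) ^ n < y / r"
    using real_arch_pow_inv[of "y / r" "1 / 2"] assms by auto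
  have ex: "\<exists>i. r / 2 ^ Suc i \<le> y"
  proof
    have "r / 2 ^ Suc n \<le> r / 2 ^ n" using assms by (simp add: field_simps)
    also have "\<dots> \<le> y" using n assms by (simp add: field_simps power_divide)
    finally show "r / 2 ^ Suc n \<le> y" .
  qed
  \<comment> \<open>Minimality yields the strict upper bound when \<open>j\<close> is a successor;
    for \<open>j = 0\<close> it is the hypothesis \<open>y < r\<close>.\<close>
  define j where "j = (LEAST i. r / 2 ^ Suc i \<le> y)"
  have "r / 2 ^ Suc j \<le> y" unfolding j_def by (rule LeastI_ex[OF ex])
  moreover have "y < r / 2 ^ j"
  proof (cases j)
    case (Suc i)
    then have "i < (LEAST i. r / 2 ^ Suc i \<le> y)" by (simp add: j_def)
    then show ?thesis using not_less_Least Suc by force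
  qed (use assms in simp)
  ultimately show ?thesis by blast
qed

lemma ball_in_sets_borel [measurable]: "ball x r \<in> sets borel"
  by simp

lemma ennreal_le_suminf: "f j \<le> (\<Sum>i. f i)" for f :: "nat \<Rightarrow> ennreal"
  using sum_le_suminf[of f "{j}"] by simp

text \<open>On each dyadic shell the power of the norm is comparable to its value at the outer
  radius, and the volume is at most that of the outer ball. The resulting series is geometric with
  ratio \<open>2 powr (- \<delta>)\<close>, which is where \<open>0 < \<delta>\<close>
  enters.\<close>

lemma nn_integral_norm_powr_ball:
  fixes \<delta> :: real
  assumes "0 < \<delta>"
  obtains K where "0 < K"
    "\<And>r. 0 < r \<Longrightarrow> (\<integral>\<^sup>+ x. ennreal (norm (x::'a::euclidean_space) powr (\<delta> - real DIM('a)))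
        * indicator (ball 0 r) x \<partial>lborel) \<le> ennreal (K * r powr \<delta>)"
proof -
  let ?N = "real DIM('a)"
  \<comment> \<open>The comparison constant on a shell for either sign of the exponent: a negative
    power is largest at the inner radius, half the outer one.\<close>
  define c where "c = max 1 (2 powr (?N - \<delta>))"
  define V where "V = unit_ball_vol ?N"
  define z where "z = 2 powr (- \<delta>)"
  have z: "0 < z" "z < 1" using assms by (auto simp: z_def powr_less_one)
  have V: "0 < V" by (simp add: V_def)
  have c: "1 \<le> c" by (simp add: c_def)
  have *: "(\<integral>\<^sup>+ x. ennreal (norm (x::'a) powr (\<delta> - ?N)) * indicator (ball 0 r) x \<partial>lborel)
      \<le> ennreal (c * V / (1 - z) * r powr \<delta>)" if r: "0 < r" for r
  proof -
    define \<rho> where "\<rho> j = r / 2 ^ j" for j :: nat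
    have \<rho>: "0 < \<rho> j" for j using r by (simp add: \<rho>_def)
    have "(\<integral>\<^sup>+ x. ennreal (norm (x::'a) powr (\<delta> - ?N)) * indicator (ball 0 r) x \<partial>lborel)
      \<le> (\<integral>\<^sup>+ x. (\<Sum>j. ennreal (c * \<rho> j powr (\<delta> - ?N)) * indicator (ball 0 (\<rho> j)) (x::'a)) \<partial>lborel)"
    proof (rule nn_integral_mono)
      fix x :: 'a
      show "ennreal (norm x powr (\<delta> - ?N)) * indicator (ball 0 r) x
        \<le> (\<Sum>j. ennreal (c * \<rho> j powr (\<delta> - ?N)) * indicator (ball 0 (\<rho> j)) x)"
      proof (cases "x \<noteq> 0 \<and> norm x < r")
        case True
        then obtain j where j: "\<rho> (Suc j) \<le> norm x" "norm x < \<rho> j"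
          using dyadic_annulus_exists[of "norm x" r] by (auto simp: \<rho>_def)
        have "norm x powr (\<delta> - ?N) \<le> c * \<rho> j powr (\<delta> - ?N)"
        proof (cases "?N \<le> \<delta>")
          case True
          then have "norm x powr (\<delta> - ?N) \<le> 1 * \<rho> j powr (\<delta> - ?N)"
            using j by (simp add: powr_mono2)
          also have "\<dots> \<le> c * \<rho> j powr (\<delta> - ?N)" using c by (intro mult_right_mono) auto
          finally show ?thesis .
        next
          case False
          then have "norm x powr (\<delta> - ?N) \<le> \<rho> (Suc j) powr (\<delta> - ?N)"
            using j \<rho>[of "Suc j"] by (intro powr_mono2') auto
          also have "\<rho> (Suc j) = \<rho> j / 2" by (simp add: \<rho>_def)
          also have "(\<rho> j / 2) powr (\<delta> - ?N) = 2 powr (?N - \<delta>) * \<rho> j powr (\<delta> - ?N)"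
            using \<rho>[of j] powr_minus_divide[of 2 "?N - \<delta>"] by (simp add: powr_divide)
          also have "\<dots> \<le> c * \<rho> j powr (\<delta> - ?N)"
            by (intro mult_right_mono) (auto simp: c_def)
          finally show ?thesis .
        qed
        then have "ennreal (norm x powr (\<delta> - ?N)) * indicator (ball 0 r) x
            \<le> ennreal (c * \<rho> j powr (\<delta> - ?N)) * indicator (ball 0 (\<rho> j)) x"
          using True j by (simp add: ennreal_leI)
        also have "\<dots> \<le> (\<Sum>j. ennreal (c * \<rho> j powr (\<delta> - ?N)) * indicator (ball 0 (\<rho> j)) x)"
          by (rule ennreal_le_suminf)
        finally show ?thesis .
      qed (auto simp: indicator_def)
    qed
    also have "\<dots> = (\<Sum>j. \<integral>\<^sup>+ x. ennreal (c * \<rho> j powr (\<delta> - ?N)) * indicator (ball 0 (\<rho> j)) (x::'a) \<partial>lborel)"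
      by (rule nn_integral_suminf) measurable
    also have "\<dots> = (\<Sum>j. ennreal (c * V * r powr \<delta> * z ^ j))"
    proof (rule suminf_cong)
      fix j
      have "(\<integral>\<^sup>+ x. ennreal (c * \<rho> j powr (\<delta> - ?N)) * indicator (ball 0 (\<rho> j)) (x::'a) \<partial>lborel)
        = ennreal (c * \<rho> j powr (\<delta> - ?N)) * ennreal (V * \<rho> j ^ DIM('a))"
        using \<rho>[of j] by (subst nn_integral_cmult) (auto simp: emeasure_ball V_def)
      also have "\<dots> = ennreal (c * V * (\<rho> j powr (\<delta> - ?N) * \<rho> j powr ?N))"
        using \<rho>[of j] c V by (simp add: powr_realpow mult_ac flip: ennreal_mult)
      also have "\<rho> j powr (\<delta> - ?N) * \<rho> j powr ?N = \<rho> j powr \<delta>"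
        by (simp flip: powr_add)
      also have "\<rho> j powr \<delta> = r powr \<delta> * z ^ j"
      proof -
        have "(2 ^ j :: real) powr \<delta> = (2 powr \<delta>) ^ j"
          by (simp add: powr_realpow[symmetric] powr_powr mult.commute)
        then show ?thesis
          using r by (simp add: \<rho>_def z_def powr_divide powr_minus power_inverse)
            (simp add: divide_inverse)
      qed
      finally show "(\<integral>\<^sup>+ x. ennreal (c * \<rho> j powr (\<delta> - ?N)) * indicator (ball 0 (\<rho> j)) (x::'a) \<partial>lborel)
        = ennreal (c * V * r powr \<delta> * z ^ j)" by (simp add: mult_ac)
    qed
    also have "\<dots> = ennreal (c * V * r powr \<delta> * (1 / (1 - z)))"
      using z c V by (intro suminf_ennreal_eq sums_mult geometric_sums) auto
    finally show ?thesis by simp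
  qed
  show ?thesis
    by (rule that[of "c * V / (1 - z)", OF _ *]) (use z c V in auto)
qed

section \<open>The weight and the growth of its measure on balls\<close>

lemma weight_ka_measurable [measurable]: "weight_ka Rp k a \<in> borel_measurable borel"
  unfolding weight_ka_def weight_k_def by measurable

lemma weight_ka_nonneg: "0 \<le> weight_ka Rp k a x"
  by (simp add: weight_ka_def weight_k_def prod_nonneg)

text \<open>Cauchy-Schwarz in each factor. The origin is excluded because
  \<open>0 powr 0 = 0\<close>: for empty \<open>Rp\<close> the left side there is 1 and the right
  side 0.\<close>

lemma weight_k_le:
  assumes "\<And>\<alpha>. \<alpha> \<in> Rp \<Longrightarrow> 0 \<le> k \<alpha>" "finite Rp" "x \<noteq> 0"
  shows "weight_k Rp k x \<le> (\<Prod>\<alpha>\<in>Rp. norm \<alpha> powr (2 * k \<alpha>)) * norm x powr (2 * total_mult Rp k)"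
proof -
  have "weight_k Rp k x \<le> (\<Prod>\<alpha>\<in>Rp. norm \<alpha> powr (2 * k \<alpha>) * norm x powr (2 * k \<alpha>))"
    unfolding weight_k_def
  proof (intro prod_mono conjI)
    fix \<alpha> assume "\<alpha> \<in> Rp"
    then have "\<bar>\<alpha> \<bullet> x\<bar> powr (2 * k \<alpha>) \<le> (norm \<alpha> * norm x) powr (2 * k \<alpha>)"
      using assms by (intro powr_mono2 Cauchy_Schwarz_ineq2) auto
    then show "\<bar>\<alpha> \<bullet> x\<bar> powr (2 * k \<alpha>) \<le> norm \<alpha> powr (2 * k \<alpha>) * norm x powr (2 * k \<alpha>)"
      by (simp add: powr_mult)
  qed simp
  also have "\<dots> = (\<Prod>\<alpha>\<in>Rp. norm \<alpha> powr (2 * k \<alpha>)) * norm x powr (2 * total_mult Rp k)"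
    using assms by (simp add: prod.distrib total_mult_def sum_distrib_left powr_sum)
  finally show ?thesis .
qed

lemma sets_mu_ka [measurable_cong]: "sets (mu_ka Rp k a) = sets borel"
  by (simp add: mu_ka_def)

lemma sigma_finite_mu_ka: "sigma_finite_measure (mu_ka Rp k a)"
  unfolding mu_ka_def
  by (subst sigma_finite_measure.sigma_finite_iff_density_finite[OF lborel.sigma_finite_measure_axioms]) auto

lemma AE_mu_ka_nonzero: "AE x in mu_ka Rp k a. x \<noteq> 0"
  unfolding mu_ka_def using AE_lborel_singleton[of 0]
  by (subst AE_density) (auto elim: eventually_mono)

text \<open>The density is at most a constant times a power of the norm, which reduces the claim to
  Lebesgue measure. Below, \<open>\<gamma> = 0\<close> bounds the measure of a ball and
  \<open>\<gamma> = \<alpha> * q\<close> the Hoelder factor.\<close>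

lemma nn_integral_mu_ka_norm_powr_ball:
  fixes Rp :: "'a::euclidean_space set"
  assumes k: "\<And>\<alpha>. \<alpha> \<in> Rp \<Longrightarrow> 0 \<le> k \<alpha>" and fin: "finite Rp" and nz: "0 \<notin> Rp"
    and \<gamma>: "\<gamma> < 2 * total_mult Rp k + real DIM('a) + a - 2"
  obtains K where "0 < K"
    "\<And>r. 0 < r \<Longrightarrow> (\<integral>\<^sup>+ x. ennreal (norm x powr (- \<gamma>)) * indicator (ball 0 r) x \<partial>mu_ka Rp k a)
        \<le> ennreal (K * r powr (2 * total_mult Rp k + real DIM('a) + a - 2 - \<gamma>))"
proof -
  let ?\<delta> = "2 * total_mult Rp k + real DIM('a) + a - 2 - \<gamma>"
  have "0 < ?\<delta>" using \<gamma> by simp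
  from nn_integral_norm_powr_ball[where 'a = 'a, OF this]
  obtain K where K: "0 < K" "\<And>r. 0 < r \<Longrightarrow> (\<integral>\<^sup>+ x. ennreal (norm (x::'a) powr (?\<delta> - real DIM('a)))
        * indicator (ball 0 r) x \<partial>lborel) \<le> ennreal (K * r powr ?\<delta>)"
    by blast
  define W where "W = (\<Prod>\<alpha>\<in>Rp. norm \<alpha> powr (2 * k \<alpha>))"
  have W: "0 < W" unfolding W_def using nz by (intro prod_pos) auto
  have *: "(\<integral>\<^sup>+ x. ennreal (norm x powr (- \<gamma>)) * indicator (ball 0 r) x \<partial>mu_ka Rp k a)
      \<le> ennreal (W * K * r powr ?\<delta>)" if r: "0 < r" for r
  proof -
    have "(\<integral>\<^sup>+ x. ennreal (norm x powr (- \<gamma>)) * indicator (ball 0 r) x \<partial>mu_ka Rp k a)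
      = (\<integral>\<^sup>+ x. ennreal (weight_ka Rp k a x) * (ennreal (norm x powr (- \<gamma>)) * indicator (ball 0 r) x) \<partial>lborel)"
      unfolding mu_ka_def by (rule nn_integral_density) measurable
    also have "\<dots> \<le> (\<integral>\<^sup>+ x. ennreal W * (ennreal (norm (x::'a) powr (?\<delta> - real DIM('a)))
        * indicator (ball 0 r) x) \<partial>lborel)"
    proof (rule nn_integral_mono)
      fix x :: 'a
      have "weight_ka Rp k a x * norm x powr (- \<gamma>) \<le> W * norm x powr (?\<delta> - real DIM('a))"
      proof (cases "x = 0")
        case False
        have "weight_ka Rp k a x * norm x powr (- \<gamma>)
            \<le> norm x powr (a - 2) * (W * norm x powr (2 * total_mult Rp k)) * norm x powr (- \<gamma>)"
          unfolding weight_ka_def W_def using False k fin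
          by (intro mult_right_mono mult_left_mono weight_k_le) auto
        also have "\<dots> = W * (norm x powr (a - 2) * norm x powr (2 * total_mult Rp k) * norm x powr (- \<gamma>))"
          by (simp add: mult_ac)
        also have "\<dots> = W * norm x powr (?\<delta> - real DIM('a))"
          by (simp add: algebra_simps flip: powr_add)
        finally show ?thesis .
      qed simp
      then show "ennreal (weight_ka Rp k a x) * (ennreal (norm x powr (- \<gamma>)) * indicator (ball 0 r) x)
          \<le> ennreal W * (ennreal (norm x powr (?\<delta> - real DIM('a))) * indicator (ball 0 r) x)"
        using W weight_ka_nonneg[of Rp k a x]
        by (simp add: indicator_def ennreal_leI flip: ennreal_mult)
    qed
    also have "\<dots> = ennreal W * (\<integral>\<^sup>+ x. ennreal (norm (x::'a) powr (?\<delta> - real DIM('a)))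
        * indicator (ball 0 r) x \<partial>lborel)"
      by (rule nn_integral_cmult) measurable
    also have "\<dots> \<le> ennreal W * ennreal (K * r powr ?\<delta>)"
      by (intro mult_left_mono K r) auto
    also have "\<dots> = ennreal (W * K * r powr ?\<delta>)"
      using W K by (simp add: mult.assoc flip: ennreal_mult)
    finally show ?thesis .
  qed
  show ?thesis by (rule that[OF _ *]) (use W K in auto)
qed

section \<open>The uncertainty inequality\<close>

text \<open>The measure enters only through its growth on balls, with \<open>D\<close> as dimension.
  The scale \<open>s\<close> stays free, to be chosen from \<open>A\<close> and \<open>B\<close>
  afterwards.\<close>

lemma split_estimate:
  fixes M :: "'a::euclidean_space measure" and q \<alpha> \<beta> D :: real
  assumes T: "L1_L2_bounded_transform M F C" and \<sigma>: "sigma_finite_measure M"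
    and sets[measurable_cong]: "sets M = sets borel"
    and nz: "AE x in M. x \<noteq> 0"
    and ball: "\<And>\<gamma>. \<gamma> < D \<Longrightarrow> \<exists>K>0. \<forall>r>0.
      (\<integral>\<^sup>+ x. ennreal (norm x powr (- \<gamma>)) * indicator (ball 0 r) x \<partial>M) \<le> ennreal (K * r powr (D - \<gamma>))"
    and p: "1 < p" "p \<le> 2" and q: "q = p / (p - 1)"
    and \<alpha>: "0 < \<alpha>" "\<alpha> < D / q" and \<beta>: "0 < \<beta>"
  obtains c where "0 < c"
    "\<And>f A B s. f \<in> Lp_space M p \<Longrightarrow> 0 < A \<Longrightarrow> 0 \<le> B \<Longrightarrow> 0 < s \<Longrightarrow>
       Lp_norm M p (norm_weighted \<alpha> f) = ennreal A \<Longrightarrow>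
       Lp_norm M q (norm_weighted \<beta> (extend M F f)) = ennreal B \<Longrightarrow>
       (\<integral>\<^sup>+ x. ennreal (cmod (extend M F f x) powr q) \<partial>M)
         \<le> ennreal (c * ((A * s powr \<alpha>) powr q + (B * s powr (- \<beta>)) powr q))"
proof -
  interpret L1_L2_bounded_transform M F C by fact
  have q1: "1 < q" and pq: "1 / p + 1 / q = 1" and pq': "p * (q - 1) = q"
    using p by (auto simp: q field_simps)
  have \<alpha>q: "\<alpha> * q < D" using \<alpha> q1 by (simp add: field_simps)
  have D: "0 < D" using \<alpha> q1 \<alpha>q by (smt (verit) mult_pos_pos)
  obtain K0 where K0: "0 < K0" "\<And>r. 0 < r \<Longrightarrow>
      (\<integral>\<^sup>+ x. ennreal (norm x powr (- 0)) * indicator (ball 0 r) x \<partial>M) \<le> ennreal (K0 * r powr (D - 0))"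
    using ball[OF D] by blast
  obtain K1 where K1: "0 < K1" "\<And>r. 0 < r \<Longrightarrow>
      (\<integral>\<^sup>+ x. ennreal (norm x powr (- (\<alpha> * q))) * indicator (ball 0 r) x \<partial>M) \<le> ennreal (K1 * r powr (D - \<alpha> * q))"
    using ball[OF \<alpha>q] by blast
  obtain H where H: "0 < H" "\<And>f E. f \<in> Lp_space M p \<Longrightarrow> 0 \<le> E \<Longrightarrow>
       (\<integral>\<^sup>+ x. ennreal (cmod (f x) powr p) \<partial>M) = ennreal E \<Longrightarrow>
       (\<integral>\<^sup>+ x. ennreal (cmod (extend M F f x) powr q) \<partial>M) \<le> ennreal (H * E powr (q - 1))"
    using hausdorff_young[OF \<sigma> p q] by blast
  \<comment> \<open>The two terms in parentheses come from the inner and the outer part of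
    \<open>f\<close>, the factor from \<open>powr_add_le\<close>; the 1 serves the region outside
    the ball of radius \<open>s\<close>.\<close>
  define c where "c = 2 powr q * (C powr q * K1 * K0 + H) + 1"
  have c: "0 < c" using C_pos K0 K1 H by (simp add: c_def add_pos_pos)
  have "(\<integral>\<^sup>+ x. ennreal (cmod (extend M F f x) powr q) \<partial>M)
         \<le> ennreal (c * ((A * s powr \<alpha>) powr q + (B * s powr (- \<beta>)) powr q))"
    if f: "f \<in> Lp_space M p" and A: "0 < A" and B: "0 \<le> B" and s: "0 < s"
      and nA: "Lp_norm M p (norm_weighted \<alpha> f) = ennreal A"
      and nB: "Lp_norm M q (norm_weighted \<beta> (extend M F f)) = ennreal B" for f A B s
  proof -
    define G where "G = extend M F f"
    \<comment> \<open>The outer part. The inner part \<open>f - f'\<close> is never transformed by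
      itself: \<open>G - G'\<close> is controlled by the bound for differences of extension
      values.\<close>
    define f' where "f' x = (if norm x < 1 / s then 0 else f x)" for x
    define G' where "G' = extend M F f'"
    have [measurable]: "f \<in> borel_measurable M" using f by (simp add: Lp_space_iff)
    have [measurable]: "f' \<in> borel_measurable M" unfolding f'_def by measurable
    have f': "f' \<in> Lp_space M p"
      by (rule Lp_space_mono[OF f]) (use p in \<open>auto simp: f'_def\<close>)
    have ext: "extension_value M F f G" "extension_value M F f' G'"
      unfolding G_def G'_def using f f' p by (auto intro!: extension_value_extend)
    then have [measurable]: "G \<in> borel_measurable M" "G' \<in> borel_measurable M"
      by (auto simp: extension_value_def)
    have iA: "(\<integral>\<^sup>+ x. ennreal (cmod (norm_weighted \<alpha> f x) powr p) \<partial>M) = ennreal (A powr p)"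
      using nA A p by (intro Lp_norm_eq_ennrealD) auto
    have iB: "(\<integral>\<^sup>+ x. ennreal (cmod (norm_weighted \<beta> G x) powr q) \<partial>M) = ennreal (B powr q)"
      using nB B q1 unfolding G_def by (intro Lp_norm_eq_ennrealD) auto
    have cm: "cmod (norm_weighted \<gamma> g x) = norm x powr \<gamma> * cmod (g x)" for \<gamma> and g :: "'a \<Rightarrow> complex" and x
      by (simp add: norm_weighted_def norm_mult)
    have [measurable]: "norm_weighted \<gamma> g \<in> borel_measurable M" if [measurable]: "g \<in> borel_measurable M" for \<gamma> g
      unfolding norm_weighted_def by measurable
    have iG': "(\<integral>\<^sup>+ x. ennreal (cmod (G' x) powr q) \<partial>M) \<le> ennreal (H * (A * s powr \<alpha>) powr q)"
    proof -
      obtain E where E: "0 \<le> E" "(\<integral>\<^sup>+ x. ennreal (cmod (f' x) powr p) \<partial>M) = ennreal E"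
        using f' by (cases "\<integral>\<^sup>+ x. ennreal (cmod (f' x) powr p) \<partial>M") (auto simp: Lp_space_iff)
      \<comment> \<open>Where \<open>f'\<close> may be nonzero, \<open>s * norm x \<ge> 1\<close>,
        so inserting the factor \<open>(s * norm x) powr \<alpha>\<close> only increases the
        modulus.\<close>
      have "cmod (f' x) powr p \<le> (s powr \<alpha>) powr p * cmod (norm_weighted \<alpha> f x) powr p" for x
      proof (cases "norm x < 1 / s")
        case False
        then have "1 \<le> s * norm x" using s by (simp add: field_simps)
        then have "1 \<le> (s * norm x) powr \<alpha>"
          using \<alpha> by (intro ge_one_powr_ge_zero) auto
        then have "1 * cmod (f x) \<le> (s * norm x) powr \<alpha> * cmod (f x)"
          by (intro mult_right_mono) auto
        then have "cmod (f x) \<le> s powr \<alpha> * (norm x powr \<alpha> * cmod (f x))"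
          by (simp add: powr_mult mult.assoc)
        then have "cmod (f x) powr p \<le> (s powr \<alpha> * (norm x powr \<alpha> * cmod (f x))) powr p"
          using p by (intro powr_mono2) auto
        then show ?thesis using False by (simp add: f'_def cm powr_mult)
      qed (simp add: f'_def)
      then have "ennreal E \<le> (\<integral>\<^sup>+ x. ennreal ((s powr \<alpha>) powr p)
          * ennreal (cmod (norm_weighted \<alpha> f x) powr p) \<partial>M)"
        unfolding E(2)[symmetric] by (intro nn_integral_mono) (simp flip: ennreal_mult)
      also have "\<dots> = ennreal ((s powr \<alpha>) powr p * A powr p)"
        by (subst nn_integral_cmult) (simp_all add: iA flip: ennreal_mult)
      finally have "E \<le> (A * s powr \<alpha>) powr p"
        using A s by (simp add: powr_mult mult.commute)
      then have "E powr (q - 1) \<le> ((A * s powr \<alpha>) powr p) powr (q - 1)"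
        using E q1 by (intro powr_mono2) auto
      also have "\<dots> = (A * s powr \<alpha>) powr q"
        by (simp only: powr_powr pq')
      finally have "H * E powr (q - 1) \<le> H * (A * s powr \<alpha>) powr q"
        using H by (intro mult_left_mono) auto
      then show ?thesis
        using H(2)[OF f' E] unfolding G'_def by (meson ennreal_leI order_trans)
    qed
    \<comment> \<open>A bound for the L^q norm of \<open>norm x powr (- \<alpha>)\<close> on the
      ball of radius \<open>1 / s\<close>, the factor paired with the weighted \<open>f\<close> in
      Hoelder's inequality.\<close>
    define V where "V = (K1 * (1 / s) powr (D - \<alpha> * q)) powr (1 / q)"
    have V: "0 < V" using K1 s by (simp add: V_def)
    have Vq: "V powr q = K1 * (1 / s) powr (D - \<alpha> * q)"
      using q1 K1 s by (simp add: V_def powr_powr)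
    have "(\<integral>\<^sup>+ x. ennreal (cmod (f x - f' x)) \<partial>M) \<le> (\<integral>\<^sup>+ x. ennreal (cmod (norm_weighted \<alpha> f x)
        * (norm x powr (- \<alpha>) * indicator (ball 0 (1 / s)) x)) \<partial>M)"
    proof (rule nn_integral_mono_AE)
      show "AE x in M. ennreal (cmod (f x - f' x)) \<le> ennreal (cmod (norm_weighted \<alpha> f x)
        * (norm x powr (- \<alpha>) * indicator (ball 0 (1 / s)) x))"
        using nz by eventually_elim (simp add: f'_def cm powr_minus field_simps)
    qed
    also have "\<dots> \<le> ennreal (A * V)"
    proof (rule nn_integral_Hoelder[OF _ _ _ _ p(1) q1 pq A V])
      have "(\<integral>\<^sup>+ x. ennreal ((norm x powr (- \<alpha>) * indicator (ball 0 (1 / s)) x) powr q) \<partial>M)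
          = (\<integral>\<^sup>+ x. ennreal (norm x powr (- (\<alpha> * q))) * indicator (ball 0 (1 / s)) x \<partial>M)"
        by (intro nn_integral_cong) (simp add: indicator_def powr_powr)
      also have "\<dots> \<le> ennreal (V powr q)"
        unfolding Vq using s by (intro K1) auto
      finally show "(\<integral>\<^sup>+ x. ennreal ((norm x powr (- \<alpha>) * indicator (ball 0 (1 / s)) x) powr q) \<partial>M)
        \<le> ennreal (V powr q)" .
    next
      show "(\<lambda>x. norm x powr (- \<alpha>) * indicator (ball 0 (1 / s)) x) \<in> borel_measurable M"
        by measurable
    qed (simp_all add: iA)
    finally have GG': "AE x in M. cmod (G x - G' x) \<le> C * (A * V)"
      using A V by (intro extension_value_diff_bound[OF ext]) auto
    define Z where "Z = (C * (A * V)) powr q"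
    \<comment> \<open>The uniform bound to the power \<open>q\<close> times the bound for the
      measure of the ball of radius \<open>s\<close>. The factors \<open>s powr D\<close> cancel
      because the balls have reciprocal radii.\<close>
    have Z: "Z * (K0 * s powr D) = C powr q * K1 * K0 * (A * s powr \<alpha>) powr q"
    proof -
      have "Z = C powr q * A powr q * K1 * (1 / s) powr (D - \<alpha> * q)"
        using C_pos A V by (simp add: Z_def powr_mult Vq)
      moreover have "(1 / s) powr (D - \<alpha> * q) * s powr D = (s powr \<alpha>) powr q"
        using s by (simp add: powr_divide powr_diff powr_powr)
      ultimately show ?thesis using A by (simp add: powr_mult mult_ac)
    qed
    have "(\<integral>\<^sup>+ x. ennreal (cmod (G x) powr q) \<partial>M)
      \<le> (\<integral>\<^sup>+ x. ennreal (2 powr q) * (ennreal Z * (ennreal (norm x powr (- 0)) * indicator (ball 0 s) x)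
            + ennreal (cmod (G' x) powr q))
          + ennreal ((s powr (- \<beta>)) powr q) * ennreal (cmod (norm_weighted \<beta> G x) powr q) \<partial>M)"
    proof (rule nn_integral_mono_AE)
      show "AE x in M. ennreal (cmod (G x) powr q)
        \<le> ennreal (2 powr q) * (ennreal Z * (ennreal (norm x powr (- 0)) * indicator (ball 0 s) x)
            + ennreal (cmod (G' x) powr q))
          + ennreal ((s powr (- \<beta>)) powr q) * ennreal (cmod (norm_weighted \<beta> G x) powr q)"
        using GG' nz
      proof eventually_elim
        case (elim x)
        have Zn: "0 \<le> Z" by (simp add: Z_def)
        show ?case
        proof (cases "norm x < s")
          case True
          have "cmod (G x) \<le> C * (A * V) + cmod (G' x)"
            using elim norm_triangle_ineq2[of "G x" "G' x"] by simp
          then have "cmod (G x) powr q \<le> (C * (A * V) + cmod (G' x)) powr q"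
            using q1 by (intro powr_mono2) auto
          also have "\<dots> \<le> 2 powr q * (Z + cmod (G' x) powr q)"
            unfolding Z_def using C_pos A V q1 by (intro powr_add_le) auto
          finally have "ennreal (cmod (G x) powr q) \<le> ennreal (2 powr q * (Z + cmod (G' x) powr q))"
            by (rule ennreal_leI)
          also have "\<dots> = ennreal (2 powr q) * (ennreal Z * (ennreal (norm x powr (- 0)) * indicator (ball 0 s) x)
            + ennreal (cmod (G' x) powr q))"
            using True elim Zn by (simp add: ennreal_mult)
          finally show ?thesis by (rule order_trans) simp
        next
          case False
          \<comment> \<open>Outside the ball the weight itself pays for the factor
            \<open>s powr (- \<beta>)\<close>.\<close>
          have "s powr \<beta> \<le> norm x powr \<beta>"
            using False s \<beta> by (intro powr_mono2) auto
          then have "cmod (G x) \<le> s powr (- \<beta>) * cmod (norm_weighted \<beta> G x)"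
            using s by (simp add: cm powr_minus field_simps mult_left_mono)
          then have "cmod (G x) powr q \<le> (s powr (- \<beta>) * cmod (norm_weighted \<beta> G x)) powr q"
            using q1 by (intro powr_mono2) auto
          then have "ennreal (cmod (G x) powr q)
            \<le> ennreal ((s powr (- \<beta>)) powr q) * ennreal (cmod (norm_weighted \<beta> G x) powr q)"
            by (simp add: powr_mult ennreal_leI flip: ennreal_mult)
          then show ?thesis by (rule order_trans) simp
        qed
      qed
    qed
    also have "\<dots> = ennreal (2 powr q) * (ennreal Z * (\<integral>\<^sup>+ x. ennreal (norm x powr (- 0)) * indicator (ball 0 s) x \<partial>M)
            + (\<integral>\<^sup>+ x. ennreal (cmod (G' x) powr q) \<partial>M))
          + ennreal ((s powr (- \<beta>)) powr q) * ennreal (B powr q)"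
      by (subst iB[symmetric]) (simp add: nn_integral_add nn_integral_cmult)
    also have "\<dots> \<le> ennreal (2 powr q) * (ennreal Z * ennreal (K0 * s powr (D - 0))
            + ennreal (H * (A * s powr \<alpha>) powr q))
          + ennreal ((s powr (- \<beta>)) powr q) * ennreal (B powr q)"
      by (intro add_mono mult_left_mono K0 iG' order_refl s) auto
    also have "\<dots> = ennreal (2 powr q * (C powr q * K1 * K0 + H) * (A * s powr \<alpha>) powr q
        + (B * s powr (- \<beta>)) powr q)"
    proof -
      have "ennreal Z * ennreal (K0 * s powr (D - 0)) = ennreal (C powr q * K1 * K0 * (A * s powr \<alpha>) powr q)"
        using K0(1) unfolding Z[symmetric] by (simp add: Z_def ennreal_mult)
      moreover have "(s powr (- \<beta>)) powr q * B powr q = (B * s powr (- \<beta>)) powr q"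
        using B by (simp add: powr_mult)
      ultimately show ?thesis
        using C_pos K0 K1 H by (simp add: algebra_simps flip: ennreal_mult ennreal_plus)
    qed
    also have "\<dots> \<le> ennreal (c * ((A * s powr \<alpha>) powr q + (B * s powr (- \<beta>)) powr q))"
    proof (rule ennreal_leI)
      have "h * x + y \<le> (h + 1) * (x + y)" if "0 \<le> h" "0 \<le> x" "0 \<le> y" for h x y :: real
        using that by (simp add: algebra_simps)
      then show "2 powr q * (C powr q * K1 * K0 + H) * (A * s powr \<alpha>) powr q + (B * s powr (- \<beta>)) powr q
          \<le> c * ((A * s powr \<alpha>) powr q + (B * s powr (- \<beta>)) powr q)"
        unfolding c_def using C_pos K0 K1 H by auto
    qed
    finally show ?thesis by (simp add: G_def)
  qed
  then show ?thesis using c that by blast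
qed

section \<open>Degenerate norms and the choice of the scale\<close>

lemma ennreal_pair_cases:
  obtains "x = 0 \<or> y = 0" | "x \<noteq> 0" "y \<noteq> 0" "x = top \<or> y = top"
  | A B where "x = ennreal A" "y = ennreal B" "0 < A" "0 < B"
proof -
  have "\<exists>A>0. z = ennreal A" if "z \<noteq> 0" "z \<noteq> top" for z
    using that by (cases z) (auto simp: less_le)
  then show ?thesis using that by metis
qed

text \<open>\<open>s\<close> is the solution of
  \<open>A * s powr \<alpha> = B * s powr (- \<beta>)\<close>.\<close>

lemma optimal_scale:
  fixes A B :: real
  assumes "0 < A" "0 < B" "0 < \<alpha>" "0 < \<beta>"
  defines "s \<equiv> (B / A) powr (1 / (\<alpha> + \<beta>))"
  shows "A * s powr \<alpha> = A powr (\<beta> / (\<alpha> + \<beta>)) * B powr (\<alpha> / (\<alpha> + \<beta>))"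
    and "B * s powr (- \<beta>) = A powr (\<beta> / (\<alpha> + \<beta>)) * B powr (\<alpha> / (\<alpha> + \<beta>))"
proof -
  have e: "1 - \<alpha> / (\<alpha> + \<beta>) = \<beta> / (\<alpha> + \<beta>)" "1 - \<beta> / (\<alpha> + \<beta>) = \<alpha> / (\<alpha> + \<beta>)"
    using assms by (simp_all add: field_simps)
  have "A * s powr \<alpha> = A powr (1 - \<alpha> / (\<alpha> + \<beta>)) * B powr (\<alpha> / (\<alpha> + \<beta>))"
    using assms by (simp add: s_def powr_powr powr_divide powr_diff)
  then show "A * s powr \<alpha> = A powr (\<beta> / (\<alpha> + \<beta>)) * B powr (\<alpha> / (\<alpha> + \<beta>))"
    by (simp add: e)
  have "B * s powr (- \<beta>) = B powr 1 * (A powr (\<beta> / (\<alpha> + \<beta>)) / B powr (\<beta> / (\<alpha> + \<beta>)))"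
    using assms by (simp add: s_def powr_powr powr_divide powr_minus)
  also have "\<dots> = A powr (\<beta> / (\<alpha> + \<beta>)) * B powr (1 - \<beta> / (\<alpha> + \<beta>))"
    by (simp only: powr_diff) simp
  finally have "B * s powr (- \<beta>) = A powr (\<beta> / (\<alpha> + \<beta>)) * B powr (1 - \<beta> / (\<alpha> + \<beta>))" .
  then show "B * s powr (- \<beta>) = A powr (\<beta> / (\<alpha> + \<beta>)) * B powr (\<alpha> / (\<alpha> + \<beta>))"
    by (simp add: e)
qed

theorem theorem5p8:
  fixes R Rp :: "'a::euclidean_space set"
    and k :: "'a \<Rightarrow> real"
    and a p q \<alpha> \<beta> C0 :: real
    and F :: "('a \<Rightarrow> complex) \<Rightarrow> ('a \<Rightarrow> complex)"
  assumes "reduced_root_system R"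
    and "positive_subsystem R Rp"
    and "multiplicity_function R k"
    and "0 < a"
    and "2 < a + 2 * total_mult Rp k + real DIM('a)"
    and "is_ka_fourier Rp k a F"
    and "\<forall>f \<in> Lp_space (mu_ka Rp k a) 1 \<inter> Lp_space (mu_ka Rp k a) 2.
           Linf_norm (mu_ka Rp k a) (F f) \<le> ennreal C0 * Lp_norm (mu_ka Rp k a) 1 f"
    and "1 < p" and "p \<le> 2"
    and "q = p / (p - 1)"
    and "0 < \<alpha>" and "\<alpha> < (2 * total_mult Rp k + real DIM('a) + a - 2) / q"
    and "0 < \<beta>"
  shows "\<exists>c::real. \<forall>f \<in> Lp_space (mu_ka Rp k a) p.
           Lp_norm (mu_ka Rp k a) q (extend (mu_ka Rp k a) F f)
           \<le> ennreal c
             * ennpowr (Lp_norm (mu_ka Rp k a) p (norm_weighted \<alpha> f)) (\<beta> / (\<alpha> + \<beta>))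
             * ennpowr (Lp_norm (mu_ka Rp k a) q (norm_weighted \<beta> (extend (mu_ka Rp k a) F f)))
                 (\<alpha> / (\<alpha> + \<beta>))"
proof -
  let ?M = "mu_ka Rp k a"
  let ?D = "2 * total_mult Rp k + real DIM('a) + a - 2"
  have q1: "1 < q" using \<open>1 < p\<close> by (simp add: \<open>q = p / (p - 1)\<close> field_simps)
  have Rp: "finite Rp" "0 \<notin> Rp" "\<And>\<alpha>. \<alpha> \<in> Rp \<Longrightarrow> 0 \<le> k \<alpha>"
    using assms(1-3)
    by (auto simp: reduced_root_system_def positive_subsystem_def multiplicity_function_def)
  \<comment> \<open>\<open>C0\<close> may have any sign, whereas the locale asks for a positive
    constant.\<close>
  interpret L1_L2_bounded_transform ?M F "max C0 1"
  proof
    show "unitary_L2 ?M F" using assms(6) by (simp add: is_ka_fourier_def)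
    fix f assume "f \<in> Lp_space ?M 1" "f \<in> Lp_space ?M 2"
    then have "Linf_norm ?M (F f) \<le> ennreal C0 * Lp_norm ?M 1 f" using assms(7) by blast
    also have "\<dots> \<le> ennreal (max C0 1) * Lp_norm ?M 1 f"
      by (intro mult_right_mono ennreal_leI) auto
    finally show "Linf_norm ?M (F f) \<le> ennreal (max C0 1) * Lp_norm ?M 1 f" .
  qed simp
  have ball: "\<exists>K>0. \<forall>r>0. (\<integral>\<^sup>+ x. ennreal (norm x powr (- \<gamma>)) * indicator (ball 0 r) x \<partial>?M)
      \<le> ennreal (K * r powr (?D - \<gamma>))" if "\<gamma> < ?D" for \<gamma>
    by (rule nn_integral_mu_ka_norm_powr_ball[OF Rp(3,1,2) that]) auto
  obtain c where c: "0 < c"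
    "\<And>f A B s. f \<in> Lp_space ?M p \<Longrightarrow> 0 < A \<Longrightarrow> 0 \<le> B \<Longrightarrow> 0 < s \<Longrightarrow>
       Lp_norm ?M p (norm_weighted \<alpha> f) = ennreal A \<Longrightarrow>
       Lp_norm ?M q (norm_weighted \<beta> (extend ?M F f)) = ennreal B \<Longrightarrow>
       (\<integral>\<^sup>+ x. ennreal (cmod (extend ?M F f x) powr q) \<partial>?M)
         \<le> ennreal (c * ((A * s powr \<alpha>) powr q + (B * s powr (- \<beta>)) powr q))"
    using split_estimate[OF L1_L2_bounded_transform_axioms sigma_finite_mu_ka sets_mu_ka
        AE_mu_ka_nonzero ball assms(8-13)] by blast
  \<comment> \<open>At the optimal scale the two terms coincide, whence the 2; the root undoes the
    power \<open>q\<close>.\<close>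
  define c' where "c' = (2 * c) powr (1 / q)"
  have c': "0 < c'" using c by (simp add: c'_def)
  have "Lp_norm ?M q (extend ?M F f)
      \<le> ennreal c' * ennpowr (Lp_norm ?M p (norm_weighted \<alpha> f)) (\<beta> / (\<alpha> + \<beta>))
        * ennpowr (Lp_norm ?M q (norm_weighted \<beta> (extend ?M F f))) (\<alpha> / (\<alpha> + \<beta>))"
    (is "?L \<le> _ * ennpowr ?A _ * ennpowr ?B _") if f: "f \<in> Lp_space ?M p" for f
  proof -
    have ext: "extension_value ?M F f (extend ?M F f)"
      using extension_value_extend[OF f] assms(8,9) by simp
    have [measurable]: "f \<in> borel_measurable ?M" "extend ?M F f \<in> borel_measurable ?M"
      using f ext by (auto simp: Lp_space_iff extension_value_def)
    have nw[measurable]: "norm_weighted \<gamma> g \<in> borel_measurable ?M"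
      if [measurable]: "g \<in> borel_measurable ?M" for \<gamma> g
      unfolding norm_weighted_def by measurable
    have nw_zero: "AE x in ?M. g x = 0"
      if "AE x in ?M. norm_weighted \<gamma> g x = 0" for \<gamma> g
      using that AE_mu_ka_nonzero by eventually_elim (simp add: norm_weighted_def)
    show ?thesis
    proof (cases rule: ennreal_pair_cases[of ?A ?B])
      \<comment> \<open>Since \<open>0 * top = 0\<close>, the right side is 0 even if the other norm
        is infinite, so the transform has to vanish almost everywhere.\<close>
      case 1
      have "AE x in ?M. extend ?M F f x = 0"
      proof (cases "?A = 0")
        case True
        then have "AE x in ?M. f x = 0"
          using nw_zero[of \<alpha> f] by (simp add: Lp_norm_eq_0_iff)
        then show ?thesis
          by (intro extension_value_zero[OF ext]) auto
      next
        case False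
        with 1 show ?thesis
          using nw_zero[of \<beta> "extend ?M F f"] by (simp add: Lp_norm_eq_0_iff)
      qed
      then have "?L = 0" by (simp add: Lp_norm_eq_0_iff)
      then show ?thesis by simp
    next
      \<comment> \<open>An infinite norm paired with a nonzero one makes the right side
        infinite.\<close>
      case 2
      have "ennpowr y r \<noteq> 0" if "y \<noteq> 0" for y r
        using that by (cases y) (auto simp: ennpowr_ennreal)
      with 2 c' have "ennreal c' * ennpowr ?A (\<beta> / (\<alpha> + \<beta>)) * ennpowr ?B (\<alpha> / (\<alpha> + \<beta>)) = top"
        by (auto simp: ennreal_mult_eq_top_iff)
      then show ?thesis by simp
    next
      case (3 A B)
      define s where "s = (B / A) powr (1 / (\<alpha> + \<beta>))"
      define P where "P = A powr (\<beta> / (\<alpha> + \<beta>)) * B powr (\<alpha> / (\<alpha> + \<beta>))"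
      have s: "0 < s" using 3 by (simp add: s_def)
      have P: "0 < P" using 3 by (simp add: P_def)
      have "A * s powr \<alpha> = P" "B * s powr (- \<beta>) = P"
        unfolding s_def P_def using optimal_scale[OF 3(3,4) assms(11,13)] by auto
      then have "(\<integral>\<^sup>+ x. ennreal (cmod (extend ?M F f x) powr q) \<partial>?M) \<le> ennreal (c * (P powr q + P powr q))"
        using c(2)[OF f 3(3) _ s 3(1,2)] 3 by simp
      also have "c * (P powr q + P powr q) = (c' * P) powr q"
        using c P q1 by (simp add: c'_def powr_mult powr_powr)
      finally have "?L \<le> ennreal (c' * P)"
        using c' P q1 by (intro Lp_norm_le) auto
      then show ?thesis
        using 3 c' by (simp add: P_def ennpowr_ennreal mult.assoc flip: ennreal_mult)
    qed
  qed
  then show ?thesis by blast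
qed

end
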